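(* Every $\mathrm{AE}(0)$-group is Baire isomorphic to a product of Polish groups.
   Context: All topological spaces are Tychonoff; maps in the definition of $\mathrm{AE}(0)$-spaces are continuous; $\dim$ is Lebesgue covering dimension. $C(X)$ is the set of continuous real-valued functions on $X$; for a map $f\colon Z_0\to X$, $C(f)(\psi)=\psi\circ f$. A space $X$ is an $\mathrm{AE}(0)$-space if for each space $Z$ with $\dim Z\le 0$ and each subspace $Z_0\subseteq Z$, every map $f\colon Z_0\to X$ such that $C(f)(C(X))\subseteq\{\varphi|Z_0\colon\varphi\in C(Z)\}$ can be extended to a map $Z\to X$. An $\mathrm{AE}(0)$-group is a topological group whose underlying space is an $\mathrm{AE}(0)$-space. Baire sets of $X$ are the elements of the $\sigma$-algebra generated by the functionally open (cozero) subsets of $X$. A (not necessarily continuous) map is a Baire map if inverse images of Baire sets are Baire sets; a bijection $f$ is a Baire isomorphism if both $f$ and $f^{-1}$ are Baire maps (no compatibility with group operations is required). Products carry the product topology. *)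

theory Defs
  imports "HOL-Analysis.Analysis" "HOL-Algebra.Group"
begin

definition Tychonoff_space :: "'a topology \<Rightarrow> bool" where
  "Tychonoff_space X \<longleftrightarrow> completely_regular_space X \<and> Hausdorff_space X"

definition functionally_open :: "'a topology \<Rightarrow> 'a set \<Rightarrow> bool" where
  "functionally_open X U \<longleftrightarrow>
     (\<exists>\<phi>. continuous_map X euclideanreal \<phi> \<and> U = {x \<in> topspace X. \<phi> x \<noteq> 0})"

text \<open>Lebesgue covering dimension of a Tychonoff space is taken, as usual, with respect to finite
  functionally open covers (for normal spaces this agrees with finite open covers).
  The last conjunct says that any \<open>n + 2\<close> distinct members have empty intersection.\<close>

definition covering_dim_le :: "'a topology \<Rightarrow> nat \<Rightarrow> bool" where
  "covering_dim_le X n \<longleftrightarrow>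
     (\<forall>\<U>. finite \<U> \<and> (\<forall>U\<in>\<U>. functionally_open X U) \<and> \<Union>\<U> = topspace X \<longrightarrow>
        (\<exists>\<V>. finite \<V> \<and> (\<forall>V\<in>\<V>. functionally_open X V) \<and> \<Union>\<V> = topspace X \<and>
             (\<forall>V\<in>\<V>. \<exists>U\<in>\<U>. V \<subseteq> U) \<and>
             (\<forall>\<W>\<subseteq>\<V>. card \<W> = n + 2 \<longrightarrow> \<Inter>\<W> = {})))"

text \<open>Every map \<open>f: Z\<^sub>0 \<rightarrow> X\<close> from a subspace of \<open>Z\<close> such that \<open>\<psi> \<circ> f\<close> extends over \<open>Z\<close> for each
  \<open>\<psi> \<in> C(X)\<close> extends itself over \<open>Z\<close>.\<close>

definition extension_property :: "'z topology \<Rightarrow> 'a topology \<Rightarrow> bool" where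
  "extension_property Z X \<longleftrightarrow>
     (\<forall>Z\<^sub>0 f. Z\<^sub>0 \<subseteq> topspace Z \<and> continuous_map (subtopology Z Z\<^sub>0) X f \<and>
        (\<forall>\<psi>. continuous_map X euclideanreal \<psi> \<longrightarrow>
           (\<exists>\<phi>. continuous_map Z euclideanreal \<phi> \<and> (\<forall>z\<in>Z\<^sub>0. \<phi> z = \<psi> (f z)))) \<longrightarrow>
        (\<exists>g. continuous_map Z X g \<and> (\<forall>z\<in>Z\<^sub>0. g z = f z)))"

text \<open>A definition in HOL cannot range over test spaces \<open>Z\<close> of all types, so their points are taken
  from \<open>('a \<Rightarrow> real) \<Rightarrow> nat \<Rightarrow> nat\<close>. This loses nothing, since the power \<open>\<nat>\<^sup>\<nat>\<close> to the \<open>C(X)\<close>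
  lives on this type and is a universal test space:
  there is a continuous \<open>p: \<nat>\<^sup>\<nat> \<rightarrow> \<real>\<close> through which every continuous \<open>\<phi>: Z \<rightarrow> \<real>\<close> with \<open>dim Z \<le> 0\<close>
  factors. Given \<open>f: Z\<^sub>0 \<rightarrow> X\<close> as above, lift the extensions of all the \<open>\<psi> \<circ> f\<close> to obtain
  \<open>h: Z \<rightarrow> (\<nat>\<^sup>\<nat>)\<close> to the \<open>C(X)\<close>. On \<open>Z\<^sub>0\<close>, \<open>f\<close> is \<open>h\<close> followed by the map \<open>f'\<close> that is defined on the
  preimage of \<open>X \<subseteq> \<real>\<close> to the \<open>C(X)\<close> under the power of \<open>p\<close>. The power has \<open>dim \<le> 0\<close>, and an
  extension of \<open>f'\<close> over it, composed with \<open>h\<close>, extends \<open>f\<close>.\<close>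

definition AE0_space :: "'a topology \<Rightarrow> bool" where
  "AE0_space X \<longleftrightarrow> Tychonoff_space X \<and>
     (\<forall>Z :: (('a \<Rightarrow> real) \<Rightarrow> nat \<Rightarrow> nat) topology.
        Tychonoff_space Z \<and> covering_dim_le Z 0 \<longrightarrow> extension_property Z X)"

definition topological_group :: "('a, 'm) monoid_scheme \<Rightarrow> 'a topology \<Rightarrow> bool" where
  "topological_group G T \<longleftrightarrow> group G \<and> topspace T = carrier G \<and>
     continuous_map (prod_topology T T) T (\<lambda>(x, y). x \<otimes>\<^bsub>G\<^esub> y) \<and>
     continuous_map T T (\<lambda>x. inv\<^bsub>G\<^esub> x)"

definition AE0_group :: "('a, 'm) monoid_scheme \<Rightarrow> 'a topology \<Rightarrow> bool" where
  "AE0_group G T \<longleftrightarrow> topological_group G T \<and> AE0_space T"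

definition Polish_group :: "('a, 'm) monoid_scheme \<Rightarrow> 'a topology \<Rightarrow> bool" where
  "Polish_group G T \<longleftrightarrow>
     topological_group G T \<and> separable_space T \<and> completely_metrizable_space T"

definition Baire_algebra :: "'a topology \<Rightarrow> 'a measure" where
  "Baire_algebra X = sigma (topspace X) {U. functionally_open X U}"

definition Baire_map :: "'a topology \<Rightarrow> 'b topology \<Rightarrow> ('a \<Rightarrow> 'b) \<Rightarrow> bool" where
  "Baire_map X Y f \<longleftrightarrow> f \<in> measurable (Baire_algebra X) (Baire_algebra Y)"

definition Baire_isomorphism :: "'a topology \<Rightarrow> 'b topology \<Rightarrow> ('a \<Rightarrow> 'b) \<Rightarrow> bool" where
  "Baire_isomorphism X Y f \<longleftrightarrow> bij_betw f (topspace X) (topspace Y) \<and>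
     Baire_map X Y f \<and> Baire_map Y X (inv_into (topspace X) f)"

definition Baire_isomorphic :: "'a topology \<Rightarrow> 'b topology \<Rightarrow> bool" where
  "Baire_isomorphic X Y \<longleftrightarrow> (\<exists>f. Baire_isomorphism X Y f)"

text \<open>In an existential statement about products of Polish groups, the types of the index set and of
  the factors have to be fixed. For spaces \<open>X\<close> on \<open>'a\<close>, index sets in \<open>'a \<Rightarrow> real\<close> and factors
  carried by subsets of \<open>nat \<Rightarrow> real\<close> suffice. Every Polish space is homeomorphic to a subspace of
  \<open>\<real>\<^sup>\<nat>\<close>, so every Polish group has a copy on a subset of \<open>nat \<Rightarrow> real\<close> (the topology of a factor is
  unrelated to any topology on that type). One-point factors can be dropped; if infinitely many
  factors remain, indexed by \<open>I\<close>, then a space in bijection with the product has at least \<open>2\<close> to the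
  \<open>|I|\<close> points, so \<open>I\<close> embeds in \<open>'a\<close>, hence in \<open>'a \<Rightarrow> real\<close>. As the latter type is infinite, it
  accommodates finite index sets too.\<close>

end

theory Submission
  imports Defs
begin

text \<open>
  Embed the group \<open>G\<close> in the power of the real line over its continuous functions. A power of the Baire
  space \<open>\<nat>\<^sup>\<nat>\<close> maps onto this power of the line by \<open>limits\<close>; it is zero-dimensional. Over \<open>G\<close>,
  the map \<open>limits\<close> takes values in \<open>G\<close>, and because \<open>G\<close> is an \<open>AE(0)\<close>-space, this
  partial map extends to a continuous map \<open>g\<close> on the whole power of \<open>\<nat>\<^sup>\<nat>\<close> with values in \<open>G\<close>
  (\<open>AE0_space_retraction\<close>). The map \<open>limits\<close> has Baire measurable sections, and for each point one that is
  continuous there. Composed with \<open>g\<close>, they give retractions onto \<open>G\<close> of the power of the line.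

  Continuous real functions on a product of second countable spaces depend on countably many
  coordinates (\<open>continuous_real_depends_on_countably_many\<close>). Applied to the coordinates of
  \<open>g z / g w\<close>, this shows that each coordinate lies in a countable autonomous set: a set \<open>A\<close> such that
  equality of the coordinates in \<open>A\<close> is a congruence of \<open>G\<close> and that the retraction acts on
  these coordinates by themselves. Unions of autonomous sets are autonomous. Well-order the coordinates
  and add countable autonomous sets one after the other. This filters \<open>G\<close> by quotients \<open>G/\<sim>\<^sub>i\<close>, in
  which each step enlarges the set of coordinates by countably many.

  Each step \<open>G/\<sim>\<^sub>i\<^sub>+\<^sub>1 \<rightarrow> G/\<sim>\<^sub>i\<close> has a Baire measurable section: pad a vector of coordinates by zeros and
  retract. Its kernel is given by countably many coordinates, is closed in a countable power of
  the line and is a topological group there; both claims follow by using, at each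
  point, a retraction that is continuous at this point. So the kernel is a Polish group
  (\<open>Polish_group_factor\<close>). Dividing by the section identifies the next quotient with the product
  of the previous one and the kernel. Transfinite recursion along the well-ordering turns this into a
  bijection between \<open>G\<close> and the product of the kernels. It is Baire measurable in both directions, because
  Baire sets are determined by coordinates, in \<open>G\<close> by its construction and in the product
  by \<open>functionally_open_countable_union_boxes\<close>.
\<close>

section \<open>Continuous functions on products of second countable spaces\<close>

locale countable_base_product =
  fixes S :: "'i \<Rightarrow> 'b topology" and I :: "'i set" and \<B> :: "'i \<Rightarrow> 'b set set"
  assumes countable_base: "i \<in> I \<Longrightarrow> countable (\<B> i)"
    and base_open: "i \<in> I \<Longrightarrow> B \<in> \<B> i \<Longrightarrow> openin (S i) B"
    and base: "i \<in> I \<Longrightarrow> openin (S i) U \<Longrightarrow> x \<in> U \<Longrightarrow> \<exists>B\<in>\<B> i. x \<in> B \<and> B \<subseteq> U"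
begin

abbreviation X :: "('i \<Rightarrow> 'b) topology" where "X \<equiv> product_topology S I"

definition box :: "'i set \<Rightarrow> ('i \<Rightarrow> 'b set) \<Rightarrow> ('i \<Rightarrow> 'b) set" where
  "box F b = {z \<in> topspace X. \<forall>i\<in>F. z i \<in> b i}"

text \<open>Codes are extensional functions so that a countable \<open>J\<close> has only countably many of them.\<close>

definition box_codes :: "'i set \<Rightarrow> ('i set \<times> ('i \<Rightarrow> 'b set)) set" where
  "box_codes J = (SIGMA F : {F. finite F \<and> F \<subseteq> J}. PiE F \<B>)"

lemma countable_box_codes:
  assumes "countable J" "J \<subseteq> I" shows "countable (box_codes J)"
  unfolding box_codes_def
  using assms countable_base
  by (intro countable_SIGMA countable_Collect_finite_subset countable_PiE) auto

lemma openin_box: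
  assumes "(F, b) \<in> box_codes I" shows "openin X (box F b)"
proof -
  have F: "finite F" "F \<subseteq> I" "\<And>i. i \<in> F \<Longrightarrow> b i \<in> \<B> i"
    using assms by (auto simp: box_codes_def)
  have "box F b = topspace X \<inter> (\<Inter>i\<in>F. {z \<in> topspace X. z i \<in> b i})"
    by (auto simp: box_def)
  moreover have "openin X {z \<in> topspace X. z i \<in> b i}" if "i \<in> F" for i
    using F that base_open
    by (intro openin_continuous_map_preimage[OF continuous_map_product_projection]) auto
  ultimately show ?thesis
    using F(1) openin_topspace[of X] by (cases "F = {}") (auto intro!: openin_Int simp del: topspace_product_topology)
qed

lemma box_base:
  assumes U: "openin X U" and z: "z \<in> U"
  obtains F b where "(F, b) \<in> box_codes I" "z \<in> box F b" "box F b \<subseteq> U"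
proof -
  obtain V where V: "finite {i \<in> I. V i \<noteq> topspace (S i)}" "\<And>i. i \<in> I \<Longrightarrow> openin (S i) (V i)"
      "z \<in> PiE I V" "PiE I V \<subseteq> U"
    using bspec[OF U[unfolded openin_product_topology_alt] z] by (elim exE conjE) blast
  define F where "F = {i \<in> I. V i \<noteq> topspace (S i)}"
  have "\<exists>B\<in>\<B> i. z i \<in> B \<and> B \<subseteq> V i" if "i \<in> F" for i
    using that V by (intro base) (auto simp: F_def PiE_iff)
  then obtain b where b: "\<And>i. i \<in> F \<Longrightarrow> b i \<in> \<B> i \<and> z i \<in> b i \<and> b i \<subseteq> V i"
    by metis
  have zX: "z \<in> topspace X"
    using U z openin_subset by blast
  have "(F, restrict b F) \<in> box_codes I"
    using V b by (auto simp: box_codes_def F_def)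
  moreover have "z \<in> box F (restrict b F)"
    using b zX by (auto simp: box_def)
  moreover have "box F (restrict b F) \<subseteq> PiE I V"
  proof
    fix w assume w: "w \<in> box F (restrict b F)"
    have "w i \<in> V i" if "i \<in> I" for i
    proof (cases "i \<in> F")
      case True then show ?thesis using w b by (auto simp: box_def)
    next
      case False then show ?thesis using w that by (auto simp: box_def F_def PiE_iff)
    qed
    then show "w \<in> PiE I V"
      using w by (auto simp: box_def PiE_iff)
  qed
  ultimately show ?thesis using that V(4) by blast
qed

text \<open>A set \<open>J\<close> of coordinates reflects \<open>U\<close> if a box inside \<open>U\<close> whose trace on some finite part
  \<open>H\<close> of \<open>J\<close> is given can be exchanged for a box inside \<open>U\<close> with the same trace on \<open>H\<close> and with
  support in \<open>J\<close>.\<close>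

definition reflects :: "('i \<Rightarrow> 'b) set \<Rightarrow> 'i set \<Rightarrow> bool" where
  "reflects U J \<longleftrightarrow> (\<forall>H F b. finite H \<and> H \<subseteq> J \<and> H \<subseteq> F \<and> (F, b) \<in> box_codes I \<and> box F b \<noteq> {} \<and> box F b \<subseteq> U
     \<longrightarrow> (\<exists>F' b'. H \<subseteq> F' \<and> (F', b') \<in> box_codes J \<and> (\<forall>i\<in>H. b' i = b i) \<and> box F' b' \<noteq> {} \<and> box F' b' \<subseteq> U))"

text \<open>A Loewenheim--Skolem argument: a countable set of coordinates carries only countably many
  possible traces \<open>(H, h)\<close>; add the finite support of one witness for each of them and iterate
  \<open>\<omega>\<close> times. Every finite \<open>H\<close> in the union appears at a finite stage.\<close>

lemma reflecting_coordinates: "\<exists>J. countable J \<and> J \<subseteq> I \<and> reflects U J"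
proof -
  define good where "good H h F b \<longleftrightarrow> H \<subseteq> F \<and> (F, b) \<in> box_codes I \<and> (\<forall>i\<in>H. b i = h i) \<and>
      box F b \<noteq> {} \<and> box F b \<subseteq> U" for H h F b
  define ext where "ext = (\<lambda>(H, h). if \<exists>F b. good H h F b then SOME F. \<exists>b. good H h F b else {})"
  have ext: "\<exists>b'. good H h (ext (H, h)) b'" if "good H h F b" for H h F b
  proof -
    have ex: "\<exists>F b. good H h F b" using that by blast
    then have "ext (H, h) = (SOME F. \<exists>b. good H h F b)" by (simp add: ext_def)
    with someI_ex[OF ex] show ?thesis by simp
  qed
  have ext_fin: "finite (ext c) \<and> ext c \<subseteq> I" for c
  proof (cases "\<exists>F b. good (fst c) (snd c) F b")
    case True
    then obtain b' where "good (fst c) (snd c) (ext c) b'" using ext[of "fst c" "snd c"] by auto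
    then show ?thesis by (auto simp: good_def box_codes_def)
  qed (auto simp: ext_def split_beta)
  define step where "step J = J \<union> (\<Union>c\<in>box_codes J. ext c)" for J
  define Jn where "Jn n = (step ^^ n) {}" for n
  have Jn: "countable (Jn n) \<and> Jn n \<subseteq> I" for n
  proof (induction n)
    case (Suc n)
    have "Jn (Suc n) = step (Jn n)" by (simp add: Jn_def)
    then show ?case
      using Suc ext_fin countable_box_codes unfolding step_def
      by (auto intro!: countable_UN intro: countable_finite)
  qed (simp add: Jn_def)
  have Jn_Suc: "Jn (Suc n) = step (Jn n)" for n by (simp add: Jn_def)
  have mono: "Jn n \<subseteq> Jn m" if "n \<le> m" for n m
    using lift_Suc_mono_le[of Jn, OF _ that] by (auto simp: Jn_Suc step_def)
  define J where "J = (\<Union>n. Jn n)"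
  have "reflects U J"
    unfolding reflects_def
  proof (intro allI impI, elim conjE)
    fix H F b
    assume H: "finite H" "H \<subseteq> J" "H \<subseteq> F" "(F, b) \<in> box_codes I" "box F b \<noteq> {}" "box F b \<subseteq> U"
    have "\<exists>n. H \<subseteq> Jn n"
    proof -
      have "\<forall>i\<in>H. \<exists>n. i \<in> Jn n" using H by (auto simp: J_def)
      then obtain m where m: "\<And>i. i \<in> H \<Longrightarrow> i \<in> Jn (m i)" by metis
      have "H \<subseteq> Jn (Max (m ` H))"
      proof
        fix i assume "i \<in> H"
        then have "m i \<le> Max (m ` H)" using H by auto
        then show "i \<in> Jn (Max (m ` H))" using m \<open>i \<in> H\<close> mono by blast
      qed
      then show ?thesis ..
    qed
    then obtain n where n: "H \<subseteq> Jn n" ..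
    define h where "h = restrict b H"
    have "good H h F b" using H by (auto simp: good_def h_def)
    from ext[OF this] obtain b' where b': "good H h (ext (H, h)) b'" ..
    have "(H, h) \<in> box_codes (Jn n)"
      using H n by (auto simp: box_codes_def h_def)
    then have "ext (H, h) \<subseteq> Jn (Suc n)"
      by (auto simp: Jn_Suc step_def)
    then have "ext (H, h) \<subseteq> J" by (auto simp: J_def)
    with b' show "\<exists>F' b'. H \<subseteq> F' \<and> (F', b') \<in> box_codes J \<and> (\<forall>i\<in>H. b' i = b i) \<and> box F' b' \<noteq> {} \<and> box F' b' \<subseteq> U"
      unfolding good_def by (intro exI[of _ "ext (H, h)"] exI[of _ b']) (auto simp: box_codes_def h_def)
  qed
  moreover have "countable J" "J \<subseteq> I" using Jn by (auto simp: J_def)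
  ultimately show ?thesis by blast
qed

definition separates :: "'i set \<Rightarrow> ('i \<Rightarrow> 'b) set \<Rightarrow> bool" where
  "separates J U \<longleftrightarrow> (\<forall>V z w. openin X V \<and> U \<inter> V = {} \<and> z \<in> U \<and> w \<in> V \<longrightarrow> (\<exists>i\<in>J. z i \<noteq> w i))"

text \<open>Suppose that \<open>z\<close> in \<open>U\<close> and \<open>w\<close> in a disjoint open set \<open>V\<close> agree on a reflecting set \<open>J\<close>.
  Choose boxes around them in \<open>U\<close> and \<open>V\<close> with the same trace on \<open>J\<close>. Exchange the first for a
  box in \<open>U\<close> with support in \<open>J\<close>. The second box restricts coordinates of \<open>J\<close> only through the
  common trace, so the two boxes meet, although \<open>U\<close> and \<open>V\<close> do not.\<close>

lemma open_set_separated_by_countably_many_coordinates: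
  assumes U: "openin X U"
  shows "\<exists>J. countable J \<and> J \<subseteq> I \<and> separates J U"
proof -
  obtain J where J: "countable J" "J \<subseteq> I" and reflect: "reflects U J"
    using reflecting_coordinates by blast
  have "separates J U"
    unfolding separates_def
  proof (intro allI impI, elim conjE, rule ccontr)
    fix V z w
    assume V: "openin X V" "U \<inter> V = {}" and zw: "z \<in> U" "w \<in> V" and "\<not> (\<exists>i\<in>J. z i \<noteq> w i)"
    then have eq: "\<And>i. i \<in> J \<Longrightarrow> z i = w i" by auto
    obtain F1 b1 where 1: "(F1, b1) \<in> box_codes I" "z \<in> box F1 b1" "box F1 b1 \<subseteq> U"
      using box_base[OF U zw(1)] by blast
    obtain F2 b2 where 2: "(F2, b2) \<in> box_codes I" "w \<in> box F2 b2" "box F2 b2 \<subseteq> V"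
      using box_base[OF V(1) zw(2)] by blast
    define H where "H = (F1 \<union> F2) \<inter> J"
    have H: "finite H" "H \<subseteq> J" "H \<subseteq> I"
      using 1 2 J by (auto simp: H_def box_codes_def)
    \<comment> \<open>Both boxes are shrunk to a common trace \<open>h\<close> on \<open>H\<close>.\<close>
    have "\<exists>B\<in>\<B> i. z i \<in> B \<and> (i \<in> F1 \<longrightarrow> B \<subseteq> b1 i) \<and> (i \<in> F2 \<longrightarrow> B \<subseteq> b2 i)" if i: "i \<in> H" for i
    proof -
      let ?O = "(if i \<in> F1 then b1 i else topspace (S i)) \<inter> (if i \<in> F2 then b2 i else topspace (S i))"
      have iI: "i \<in> I" "i \<in> J" using i H by auto
      have "openin (S i) ?O"
        using 1(1) 2(1) base_open[OF iI(1)] PiE_mem[of b1 F1 \<B> i] PiE_mem[of b2 F2 \<B> i]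
        by (intro openin_Int) (auto simp: box_codes_def)
      moreover have "z i \<in> ?O"
        using 1(2) 2(2) iI eq[OF iI(2)] by (auto simp: box_def PiE_iff)
      ultimately obtain B where B: "B \<in> \<B> i" "z i \<in> B" "B \<subseteq> ?O"
        using base[OF iI(1)] by blast
      then show ?thesis
        by (intro bexI[of _ B]) (auto split: if_splits)
    qed
    then obtain h where h: "\<And>i. i \<in> H \<Longrightarrow> h i \<in> \<B> i \<and> z i \<in> h i"
      "\<And>i. i \<in> H \<Longrightarrow> i \<in> F1 \<Longrightarrow> h i \<subseteq> b1 i" "\<And>i. i \<in> H \<Longrightarrow> i \<in> F2 \<Longrightarrow> h i \<subseteq> b2 i"
      by metis
    define F b where "F = F1 \<union> H" and "b = (\<lambda>i. if i \<in> H then h i else b1 i)"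
    have "(F, b) \<in> box_codes I"
      using 1 H h by (auto simp: box_codes_def F_def b_def PiE_iff extensional_def)
    moreover have "z \<in> box F b"
      using 1 h by (auto simp: box_def F_def b_def)
    moreover have "box F b \<subseteq> U"
    proof -
      have "box F b \<subseteq> box F1 b1"
        using h by (fastforce simp: box_def F_def b_def split: if_splits)
      then show ?thesis using 1 by blast
    qed
    moreover have "H \<subseteq> F" by (simp add: F_def)
    ultimately have "\<exists>F' b'. H \<subseteq> F' \<and> (F', b') \<in> box_codes J \<and> (\<forall>i\<in>H. b' i = b i) \<and> box F' b' \<noteq> {} \<and> box F' b' \<subseteq> U"
      using H by (intro reflect[unfolded reflects_def, rule_format] conjI) auto
    then obtain F' b' where F': "H \<subseteq> F'" "(F', b') \<in> box_codes J" "\<forall>i\<in>H. b' i = b i"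
        "box F' b' \<noteq> {}" "box F' b' \<subseteq> U"
      by blast
    then obtain w' where w': "w' \<in> box F' b'" by blast
    \<comment> \<open>This point lies in both boxes.\<close>
    define v where "v = (\<lambda>i. if i \<in> J then w' i else w i)"
    have vX: "v \<in> topspace X"
      using w' 2 J by (auto simp: v_def box_def PiE_iff extensional_def)
    have "v \<in> box F' b'"
      using w' vX F'(2) by (auto simp: box_def v_def box_codes_def)
    moreover have "v \<in> box F2 b2"
    proof -
      have "v i \<in> b2 i" if i: "i \<in> F2" for i
      proof (cases "i \<in> J")
        case True
        then have "i \<in> H" using i by (auto simp: H_def)
        then have "b' i = h i" "i \<in> F'" using F' by (auto simp: b_def)
        moreover have "w' i \<in> b' i" using w' \<open>i \<in> F'\<close> by (simp add: box_def)
        ultimately show ?thesis using h(3)[OF \<open>i \<in> H\<close> i] True by (auto simp: v_def)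
      next
        case False then show ?thesis using 2 i by (auto simp: v_def box_def)
      qed
      then show ?thesis using vX by (auto simp: box_def)
    qed
    ultimately show False using F' 2 V by blast
  qed
  with J show ?thesis by blast
qed

text \<open>If \<open>\<phi> z < q < \<phi> w\<close> with \<open>q\<close> rational, then the countable set of coordinates that separates
  \<open>{\<phi> < q}\<close> from its exterior distinguishes \<open>z\<close> and \<open>w\<close>. Collect these sets over all \<open>q\<close>.\<close>

theorem continuous_real_depends_on_countably_many:
  fixes \<phi> :: "('i \<Rightarrow> 'b) \<Rightarrow> real"
  assumes \<phi>: "continuous_map X euclideanreal \<phi>"
  shows "\<exists>J. countable J \<and> J \<subseteq> I \<and>
    (\<forall>z\<in>topspace X. \<forall>w\<in>topspace X. (\<forall>i\<in>J. z i = w i) \<longrightarrow> \<phi> z = \<phi> w)"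
proof -
  have op: "openin X {z \<in> topspace X. \<phi> z \<in> A}" if "open A" for A
    using that by (intro openin_continuous_map_preimage[OF \<phi>]) simp
  define below where "below q = {z \<in> topspace X. \<phi> z \<in> {..<q}}" for q
  have "openin X (below q)" for q
    unfolding below_def by (rule op) simp
  then have "\<forall>q. \<exists>J. countable J \<and> J \<subseteq> I \<and> separates J (below q)"
    by (intro allI open_set_separated_by_countably_many_coordinates)
  then obtain J where J: "\<And>q. countable (J q)" "\<And>q. J q \<subseteq> I" and sep: "\<And>q. separates (J q) (below q)"
    by metis
  define K where "K = (\<Union>q\<in>\<rat>. J q)"
  have le: "\<phi> w \<le> \<phi> z" if zw: "z \<in> topspace X" "w \<in> topspace X" and eq: "\<And>i. i \<in> K \<Longrightarrow> z i = w i" for z w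
  proof (rule ccontr)
    assume "\<not> \<phi> w \<le> \<phi> z"
    then obtain q where q: "q \<in> \<rat>" "\<phi> z < q" "q < \<phi> w"
      using Rats_dense_in_real[of "\<phi> z" "\<phi> w"] by auto
    have "openin X {z \<in> topspace X. \<phi> z \<in> {q<..}}" by (rule op) simp
    moreover have "below q \<inter> {z \<in> topspace X. \<phi> z \<in> {q<..}} = {}"
      "z \<in> below q" "w \<in> {z \<in> topspace X. \<phi> z \<in> {q<..}}"
      using q zw by (auto simp: below_def)
    ultimately have "\<exists>i\<in>J q. z i \<noteq> w i"
      using sep[of q] unfolding separates_def by blast
    then show False using eq q by (auto simp: K_def)
  qed
  have "\<phi> z = \<phi> w" if "z \<in> topspace X" "w \<in> topspace X" "\<forall>i\<in>K. z i = w i" for z w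
    using le[of z w] le[of w z] that by fastforce
  moreover have "countable K" "K \<subseteq> I" using J countable_rat by (auto simp: K_def)
  ultimately show ?thesis by blast
qed

text \<open>A set that depends on the coordinates in \<open>J\<close> only contains with every box also the larger box
  that ignores the coordinates outside \<open>J\<close>, and there are countably many boxes with support in \<open>J\<close>.\<close>

theorem functionally_open_countable_union_boxes:
  assumes "functionally_open X U"
  obtains \<Q> where "countable \<Q>" "\<Q> \<subseteq> box_codes I" "U = (\<Union>(F, b)\<in>\<Q>. box F b)"
proof -
  obtain \<phi> where \<phi>: "continuous_map X euclideanreal \<phi>" and U: "U = {x \<in> topspace X. \<phi> x \<noteq> 0}"
    using assms by (auto simp: functionally_open_def)
  obtain J where J: "countable J" "J \<subseteq> I"
    and dep: "\<forall>z\<in>topspace X. \<forall>w\<in>topspace X. (\<forall>i\<in>J. z i = w i) \<longrightarrow> \<phi> z = \<phi> w"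
    using continuous_real_depends_on_countably_many[OF \<phi>] by blast
  have opU: "openin X U"
  proof -
    have "U = {x \<in> topspace X. \<phi> x \<in> - {0}}" using U by auto
    moreover have "openin X {x \<in> topspace X. \<phi> x \<in> - {0}}"
      by (rule openin_continuous_map_preimage[OF \<phi>]) auto
    ultimately show ?thesis by simp
  qed
  define \<Q> where "\<Q> = {(F, b) \<in> box_codes J. box F b \<subseteq> U}"
  show ?thesis
  proof (rule that)
    show "countable \<Q>"
      by (rule countable_subset[OF _ countable_box_codes[OF J]]) (auto simp: \<Q>_def)
    show "\<Q> \<subseteq> box_codes I" using J by (auto simp: \<Q>_def box_codes_def)
    show "U = (\<Union>(F, b)\<in>\<Q>. box F b)"
    proof
      show "U \<subseteq> (\<Union>(F, b)\<in>\<Q>. box F b)"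
      proof
        fix z assume z: "z \<in> U"
        then obtain F b where Fb: "(F, b) \<in> box_codes I" "z \<in> box F b" "box F b \<subseteq> U"
          using box_base[OF opU] by blast
        have "box (F \<inter> J) (restrict b (F \<inter> J)) \<subseteq> U"
        proof
          fix w assume w: "w \<in> box (F \<inter> J) (restrict b (F \<inter> J))"
          define v where "v = (\<lambda>i. if i \<in> J then w i else z i)"
          have v: "v \<in> topspace X"
            using w z J by (auto simp: v_def box_def PiE_iff extensional_def U)
          have "v \<in> box F b" using w Fb(2) v by (auto simp: box_def v_def)
          then have "v \<in> U" using Fb by blast
          moreover have "w \<in> topspace X" "\<forall>i\<in>J. v i = w i" using w by (auto simp: v_def box_def)
          then have "\<phi> v = \<phi> w" using dep v by blast
          ultimately show "w \<in> U" using w by (auto simp: U box_def)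
        qed
        moreover have "(F \<inter> J, restrict b (F \<inter> J)) \<in> box_codes J"
          using Fb by (auto simp: box_codes_def)
        moreover have "z \<in> box (F \<inter> J) (restrict b (F \<inter> J))"
          using Fb by (auto simp: box_def)
        ultimately show "z \<in> (\<Union>(F, b)\<in>\<Q>. box F b)"
          by (auto simp: \<Q>_def)
      qed
    qed (auto simp: \<Q>_def)
  qed
qed

end

section \<open>The real line as an image of the Baire space\<close>

definition rat_enum :: "nat \<Rightarrow> real" where "rat_enum k = of_rat (nat_to_rat_surj k)"

lemma rat_enum_dense: assumes "0 < r" shows "\<exists>k. \<bar>x - rat_enum k\<bar> < r"
proof -
  obtain q where q: "x < of_rat q" "of_rat q < x + r"
    using of_rat_dense[of x "x + r"] assms by auto
  obtain k where "q = nat_to_rat_surj k" using surj_nat_to_rat_surj by (metis surjD)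
  then have "\<bar>x - rat_enum k\<bar> < r" using q by (simp add: rat_enum_def)
  then show ?thesis ..
qed

definition clamp_to :: "real \<Rightarrow> real \<Rightarrow> real" where "clamp_to r t = max (- r) (min r t)"

text \<open>The limit of the rationals with numbers \<open>z 0, z 1, \<dots>\<close>, as a telescoping series. Clamping the
  \<open>n\<close>-th increment to \<open>2\<^sup>-\<^sup>n\<close> makes the series converge uniformly for all \<open>z\<close>, hence the sum continuous,
  without changing its value for sequences that converge fast.\<close>

definition limit_real :: "(nat \<Rightarrow> nat) \<Rightarrow> real" where
  "limit_real z = rat_enum (z 0) +
     (\<Sum>n. clamp_to ((1/2)^n) (rat_enum (z (Suc n)) - rat_enum (z n)))"

lemma abs_clamp_to_le: "0 \<le> r \<Longrightarrow> \<bar>clamp_to r t\<bar> \<le> r"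
  by (auto simp: clamp_to_def)

lemma clamp_to_id: "\<bar>t\<bar> \<le> r \<Longrightarrow> clamp_to r t = t"
  by (auto simp: clamp_to_def)

lemma continuous_on_limit_real: "continuous_on UNIV limit_real"
proof -
  have c: "continuous_on UNIV (\<lambda>z::nat \<Rightarrow> nat. rat_enum (z n))" for n
    by (rule continuous_on_compose2[of UNIV rat_enum]) auto
  have "uniform_limit UNIV (\<lambda>N z. \<Sum>n<N. clamp_to ((1/2)^n) (rat_enum (z (Suc n)) - rat_enum (z n)))
      (\<lambda>z. \<Sum>n. clamp_to ((1/2)^n) (rat_enum (z (Suc n)) - rat_enum (z n))) sequentially"
    by (rule Weierstrass_m_test[where M = "\<lambda>n. (1/2)^n"]) (auto intro!: abs_clamp_to_le summable_geometric)
  then have "continuous_on UNIV (\<lambda>z. \<Sum>n. clamp_to ((1/2)^n) (rat_enum (z (Suc n)) - rat_enum (z n)))"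
    by (rule uniform_limit_theorem[rotated])
       (auto simp: clamp_to_def intro!: always_eventually continuous_intros c)
  then show ?thesis
    unfolding limit_real_def by (intro continuous_intros c)
qed

lemma limit_real_eqI:
  assumes z: "\<And>n. \<bar>y - rat_enum (z n)\<bar> < (1/2)^n / 4"
  shows "limit_real z = y"
proof -
  have "(\<lambda>n. rat_enum (z n)) \<longlonglongrightarrow> y"
  proof (rule LIM_zero_cancel, rule tendsto_0_le[where K = 1])
    show "(\<lambda>n. (1/2)^n :: real) \<longlonglongrightarrow> 0" by (simp add: LIMSEQ_power_zero)
    have "norm (rat_enum (z n) - y) \<le> norm ((1/2)^n :: real) * 1" for n
    proof -
      have "(1/2)^n / 4 \<le> ((1/2)^n :: real)" by simp
      then have "\<bar>rat_enum (z n) - y\<bar> \<le> (1/2)^n" using z[of n] by linarith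
      then show ?thesis by simp
    qed
    then show "\<forall>\<^sub>F n in sequentially. norm (rat_enum (z n) - y) \<le> norm ((1/2)^n :: real) * 1"
      by (intro always_eventually allI)
  qed
  then have "(\<lambda>n. rat_enum (z (Suc n)) - rat_enum (z n)) sums (y - rat_enum (z 0))"
    by (rule telescope_sums)
  moreover have "clamp_to ((1/2)^n) (rat_enum (z (Suc n)) - rat_enum (z n)) = rat_enum (z (Suc n)) - rat_enum (z n)" for n
  proof (rule clamp_to_id)
    have "(1/2)^Suc n / 4 \<le> (1/2)^n / (4 :: real)" by simp
    then have "\<bar>y - rat_enum (z (Suc n))\<bar> < (1/2)^n / 4" using z[of "Suc n"] by linarith
    then show "\<bar>rat_enum (z (Suc n)) - rat_enum (z n)\<bar> \<le> (1/2)^n" using z[of n] by linarith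
  qed
  ultimately show ?thesis
    by (simp add: limit_real_def sums_iff)
qed

definition near_code :: "real \<Rightarrow> nat \<Rightarrow> nat" where
  "near_code y n = (LEAST k. \<bar>y - rat_enum k\<bar> < (1/2)^n / 4)"

lemma near_code: "\<bar>y - rat_enum (near_code y n)\<bar> < (1/2)^n / 4"
  unfolding near_code_def by (rule LeastI_ex) (rule rat_enum_dense, simp)

text \<open>A section of \<open>limit_real\<close> for each base point \<open>x\<close>: it follows the sequence chosen for \<open>x\<close> as long as
  that approximates \<open>y\<close> well enough. A section cannot be continuous everywhere, but this one is
  continuous at \<open>x\<close>; and it is measurable.\<close>

definition lift_real :: "real \<Rightarrow> real \<Rightarrow> nat \<Rightarrow> nat" where
  "lift_real x y n =
     (if \<bar>y - rat_enum (near_code x n)\<bar> < (1/2)^n / 4 then near_code x n else near_code y n)"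

lemma limit_real_lift_real [simp]: "limit_real (lift_real x y) = y"
  by (rule limit_real_eqI) (use near_code[of y] in \<open>auto simp: lift_real_def\<close>)

lemma lift_real_locally_constant:
  assumes "(f \<longlongrightarrow> x) F" shows "\<forall>\<^sub>F k in F. lift_real x (f k) n = lift_real x x n"
proof -
  have "((\<lambda>k. \<bar>f k - rat_enum (near_code x n)\<bar>) \<longlongrightarrow> \<bar>x - rat_enum (near_code x n)\<bar>) F"
    by (intro tendsto_intros assms)
  then have "\<forall>\<^sub>F k in F. \<bar>f k - rat_enum (near_code x n)\<bar> < (1/2)^n / 4"
    by (rule order_tendstoD) (rule near_code)
  then show ?thesis
    by eventually_elim (auto simp: lift_real_def)
qed

lemma measurable_lift_real: "lift_real x \<in> borel \<rightarrow>\<^sub>M borel"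
proof -
  have "(\<lambda>y. lift_real x y n) \<in> borel \<rightarrow>\<^sub>M count_space UNIV" for n
    unfolding lift_real_def near_code_def by measurable
  then have "(\<lambda>y n. lift_real x y n) \<in> borel \<rightarrow>\<^sub>M (Pi\<^sub>M UNIV (\<lambda>_. borel))"
    by (intro measurable_PiM_single') (auto simp: measurable_cong_sets[OF refl sets_borel_eq_count_space])
  then show ?thesis
    using sets_PiM_equal_borel[where 'a = nat and 'b = nat] by (simp cong: measurable_cong_sets)
qed

definition limits :: "('i \<Rightarrow> nat \<Rightarrow> nat) \<Rightarrow> 'i \<Rightarrow> real" where
  "limits z i = limit_real (z i)"

definition lifts :: "('i \<Rightarrow> real) \<Rightarrow> ('i \<Rightarrow> real) \<Rightarrow> 'i \<Rightarrow> nat \<Rightarrow> nat" where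
  "lifts x t i = lift_real (x i) (t i)"

lemma limits_lifts [simp]: "limits (lifts x t) = t"
  by (simp add: limits_def lifts_def fun_eq_iff)

lemma continuous_on_limits_coordinate: "continuous_on UNIV (\<lambda>z. limits z i)"
  unfolding limits_def
  by (rule continuous_on_compose2[OF continuous_on_limit_real]) auto

lemma tendsto_coordinatewise:
  fixes f :: "'k \<Rightarrow> 'i \<Rightarrow> 'b::topological_space"
  assumes "\<And>i. ((\<lambda>k. f k i) \<longlongrightarrow> l i) F" shows "(f \<longlongrightarrow> l) F"
proof -
  have "limitin (product_topology (\<lambda>_. euclidean) UNIV) f l F"
    using assms by (simp add: limitin_componentwise)
  then show ?thesis by (simp add: euclidean_product_topology)
qed

lemma tendsto_lifts:
  assumes "((\<lambda>k. t k i) \<longlongrightarrow> x i) F"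
  shows "((\<lambda>k. lifts x (t k) i) \<longlongrightarrow> lifts x x i) F"
proof (rule tendsto_coordinatewise)
  fix n
  show "((\<lambda>k. lifts x (t k) i n) \<longlongrightarrow> lifts x x i n) F"
    unfolding lifts_def by (rule tendsto_eventually) (rule lift_real_locally_constant[OF assms])
qed

lemma measurable_lifts:
  assumes "\<And>i. (\<lambda>k. t k i) \<in> borel_measurable M"
  shows "(\<lambda>k. lifts x (t k)) \<in> M \<rightarrow>\<^sub>M Pi\<^sub>M UNIV (\<lambda>_. borel)"
  using measurable_compose[OF assms measurable_lift_real]
  by (intro measurable_PiM_single') (auto simp: lifts_def)

section \<open>Baire measurability\<close>

lemma functionally_open_subset: "functionally_open X U \<Longrightarrow> U \<subseteq> topspace X"
  by (auto simp: functionally_open_def)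

lemma space_Baire_algebra [simp]: "space (Baire_algebra X) = topspace X"
  by (simp add: Baire_algebra_def space_measure_of_conv)

lemma sets_Baire_algebra_functionally_open:
  "functionally_open X U \<Longrightarrow> U \<in> sets (Baire_algebra X)"
  unfolding Baire_algebra_def using functionally_open_subset[of X]
  by (subst sets_measure_of) (auto intro: sigma_sets.Basic)

lemma measurable_Baire_algebraI:
  assumes "f \<in> space M \<rightarrow> topspace X"
    and "\<And>U. functionally_open X U \<Longrightarrow> f -` U \<inter> space M \<in> sets M"
  shows "f \<in> M \<rightarrow>\<^sub>M Baire_algebra X"
  unfolding Baire_algebra_def
  using assms functionally_open_subset[of X] by (intro measurable_measure_of) auto

lemma borel_measurable_Baire_algebra:
  assumes \<phi>: "continuous_map X euclideanreal \<phi>"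
  shows "\<phi> \<in> borel_measurable (Baire_algebra X)"
proof (rule borel_measurableI_greater)
  fix q :: real
  have "continuous_map X euclideanreal (\<lambda>x. max (\<phi> x - q) 0)"
    by (intro continuous_intros \<phi>)
  then have "functionally_open X {x \<in> topspace X. max (\<phi> x - q) 0 \<noteq> 0}"
    unfolding functionally_open_def by blast
  moreover have "{x \<in> topspace X. max (\<phi> x - q) 0 \<noteq> 0} = {x \<in> space (Baire_algebra X). \<phi> x > q}"
    by auto
  ultimately show "{x \<in> space (Baire_algebra X). \<phi> x > q} \<in> sets (Baire_algebra X)"
    using sets_Baire_algebra_functionally_open by metis
qed

lemma measurable_Baire_algebra_iff:
  "f \<in> M \<rightarrow>\<^sub>M Baire_algebra X \<longleftrightarrow> f \<in> space M \<rightarrow> topspace X \<and>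
     (\<forall>\<phi>. continuous_map X euclideanreal \<phi> \<longrightarrow> (\<lambda>x. \<phi> (f x)) \<in> borel_measurable M)" (is "?L \<longleftrightarrow> ?R")
proof
  assume L: ?L
  then show ?R
    using measurable_space[OF L] measurable_compose[OF L borel_measurable_Baire_algebra] by auto
next
  assume R: ?R
  show ?L
  proof (rule measurable_Baire_algebraI)
    show "f \<in> space M \<rightarrow> topspace X" using R by blast
    fix U assume "functionally_open X U"
    then obtain \<phi> where \<phi>: "continuous_map X euclideanreal \<phi>" "U = {x \<in> topspace X. \<phi> x \<noteq> 0}"
      by (auto simp: functionally_open_def)
    have "(\<lambda>x. \<phi> (f x)) \<in> borel_measurable M" using R \<phi> by blast
    then have "(\<lambda>x. \<phi> (f x)) -` (- {0}) \<inter> space M \<in> sets M"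
      by (rule measurable_sets) auto
    moreover have "f -` U \<inter> space M = (\<lambda>x. \<phi> (f x)) -` (- {0}) \<inter> space M"
      using R \<phi> by auto
    ultimately show "f -` U \<inter> space M \<in> sets M" by simp
  qed
qed

context countable_base_product
begin

text \<open>Although a product with uncountably many factors may have many more open sets, its Baire sets are
  generated by the coordinate projections, as its functionally open sets are countable unions of
  boxes.\<close>

lemma measurable_product_Baire_algebraI:
  assumes f: "f \<in> space M \<rightarrow> topspace X"
    and meas: "\<And>i B. i \<in> I \<Longrightarrow> B \<in> \<B> i \<Longrightarrow> {x \<in> space M. f x i \<in> B} \<in> sets M"
  shows "f \<in> M \<rightarrow>\<^sub>M Baire_algebra X"
proof (rule measurable_Baire_algebraI[OF f])
  fix U assume "functionally_open X U"
  then obtain \<Q> where \<Q>: "countable \<Q>" "\<Q> \<subseteq> box_codes I" "U = (\<Union>(F, b)\<in>\<Q>. box F b)"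
    by (rule functionally_open_countable_union_boxes)
  have "f -` box F b \<inter> space M \<in> sets M" if "(F, b) \<in> \<Q>" for F b
  proof -
    have F: "finite F" "F \<subseteq> I" "\<And>i. i \<in> F \<Longrightarrow> b i \<in> \<B> i"
      using that \<Q> by (auto simp: box_codes_def)
    have "f -` box F b \<inter> space M = {x \<in> space M. \<forall>i\<in>F. f x i \<in> b i}"
      using f by (auto simp: box_def)
    also have "\<dots> \<in> sets M"
      using F meas by (cases "F = {}") (auto intro!: sets.sets_Collect_finite_All')
    finally show ?thesis .
  qed
  then have "(\<Union>(F, b)\<in>\<Q>. f -` box F b \<inter> space M) \<in> sets M"
    using \<Q>(1) by (intro sets.countable_UN'') auto
  moreover have "f -` U \<inter> space M = (\<Union>(F, b)\<in>\<Q>. f -` box F b \<inter> space M)"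
    using \<Q>(3) by auto
  ultimately show "f -` U \<inter> space M \<in> sets M" by simp
qed

text \<open>Each member of a cover is a countable union of boxes, which are clopen here. Enumerate all
  these boxes and let each point choose the first one that contains it: this splits the space into
  disjoint clopen sets, grouped by the member of the cover from which the box was taken.\<close>

theorem covering_dim_le_0:
  assumes clopen: "\<And>i B. i \<in> I \<Longrightarrow> B \<in> \<B> i \<Longrightarrow> closedin (S i) B"
  shows "covering_dim_le X 0"
  unfolding covering_dim_le_def
proof (intro allI impI, elim conjE)
  fix \<U> assume \<U>: "finite \<U>" "\<forall>U\<in>\<U>. functionally_open X U" "\<Union>\<U> = topspace X"
  have "\<exists>\<Q>. countable \<Q> \<and> \<Q> \<subseteq> box_codes I \<and> U = (\<Union>(F, b)\<in>\<Q>. box F b)" if "U \<in> \<U>" for U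
    by (rule functionally_open_countable_union_boxes[of U]) (use \<U> that in blast)+
  then obtain \<Q> where \<Q>: "\<And>U. U \<in> \<U> \<Longrightarrow> countable (\<Q> U)" "\<And>U. U \<in> \<U> \<Longrightarrow> \<Q> U \<subseteq> box_codes I"
      and \<Q>_Un: "\<And>U. U \<in> \<U> \<Longrightarrow> (\<Union>(F, b)\<in>\<Q> U. box F b) = U"
    by metis
  have closed_box: "closedin X (box F b)" if "(F, b) \<in> box_codes I" for F b
  proof -
    have F: "finite F" "F \<subseteq> I" "\<And>i. i \<in> F \<Longrightarrow> b i \<in> \<B> i"
      using that by (auto simp: box_codes_def)
    have "closedin X {z \<in> topspace X. z i \<in> b i}" if "i \<in> F" for i
      using F that clopen
      by (intro closedin_continuous_map_preimage[OF continuous_map_product_projection]) auto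
    moreover have "box F b = topspace X \<inter> (\<Inter>i\<in>F. {z \<in> topspace X. z i \<in> b i})"
      by (auto simp: box_def)
    ultimately show ?thesis
      using closedin_topspace[of X] by (cases "F = {}") (auto intro!: closedin_Int simp del: topspace_product_topology)
  qed
  show "\<exists>\<V>. finite \<V> \<and> (\<forall>V\<in>\<V>. functionally_open X V) \<and> \<Union>\<V> = topspace X \<and>
      (\<forall>V\<in>\<V>. \<exists>U\<in>\<U>. V \<subseteq> U) \<and> (\<forall>\<W>\<subseteq>\<V>. card \<W> = 0 + 2 \<longrightarrow> \<Inter>\<W> = {})"
  proof (cases "topspace X = {}")
    case True then show ?thesis by (intro exI[of _ "{}"]) (auto simp del: topspace_product_topology)
  next
    case False
    define P where "P = (SIGMA U:\<U>. \<Q> U)"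
    have P: "countable P" using \<U>(1) \<Q>(1) by (auto simp: P_def intro: countable_finite)
    have "P \<noteq> {}"
    proof -
      obtain z where "z \<in> \<Union>\<U>" using False \<U>(3) by blast
      then obtain U where "U \<in> \<U>" "z \<in> U" by blast
      then have "\<Q> U \<noteq> {}" using \<Q>_Un[of U] by auto
      then show ?thesis using \<open>U \<in> \<U>\<close> by (auto simp: P_def)
    qed
    define e where "e = from_nat_into P"
    have e_P: "e n \<in> P" for n using \<open>P \<noteq> {}\<close> by (simp add: e_def from_nat_into)
    have e_onto: "\<exists>n. e n = p" if "p \<in> P" for p
      using that P by (metis e_def from_nat_into_surj)
    define u where "u n = fst (e n)" for n
    define C where "C n = (case snd (e n) of (F, b) \<Rightarrow> box F b)" for n
    have eQ: "snd (e n) \<in> \<Q> (u n)" and uU: "u n \<in> \<U>" for n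
      using e_P[of n] by (auto simp: P_def u_def)
    have code: "snd (e n) \<in> box_codes I" for n using eQ uU \<Q>(2) by blast
    have C_clopen: "openin X (C n)" "closedin X (C n)" for n
      using code[of n] openin_box closed_box by (auto simp: C_def split: prod.splits)
    have C_u: "C n \<subseteq> u n" for n
    proof -
      have "C n \<subseteq> (\<Union>(F, b)\<in>\<Q> (u n). box F b)"
        using eQ[of n] unfolding C_def by (intro UN_upper[of "snd (e n)" _ "\<lambda>c. case c of (F, b) \<Rightarrow> box F b"])
      then show ?thesis by (simp only: \<Q>_Un[OF uU])
    qed
    have cover: "\<exists>n. z \<in> C n" if "z \<in> topspace X" for z
    proof -
      have "z \<in> \<Union>\<U>" using that by (simp only: \<U>(3))
      then obtain U where U: "U \<in> \<U>" "z \<in> U" by blast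
      have "z \<in> (\<Union>(F, b)\<in>\<Q> U. box F b)" unfolding \<Q>_Un[OF U(1)] by (rule U(2))
      then obtain F b where Fb: "(F, b) \<in> \<Q> U" "z \<in> box F b" by blast
      then obtain n where "e n = (U, (F, b))" using e_onto[of "(U, (F, b))"] U by (auto simp: P_def)
      then show ?thesis using Fb by (intro exI[of _ n]) (simp add: C_def)
    qed
    define first where "first z = (LEAST n. z \<in> C n)" for z
    have first: "z \<in> C (first z)" if "z \<in> topspace X" for z
      unfolding first_def using cover[OF that] by (rule LeastI_ex)
    define V where "V U = {z \<in> topspace X. u (first z) = U}" for U
    have open_first: "openin X {z \<in> topspace X. first z = n}" for n
    proof -
      have "{z \<in> topspace X. first z = n} = C n - (\<Union>m<n. C m)"
      proof (intro equalityI subsetI)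
        fix z assume "z \<in> {z \<in> topspace X. first z = n}"
        then have z: "z \<in> topspace X" "first z = n" by auto
        have "z \<notin> C m" if "m < n" for m
          using that z(2) not_less_Least unfolding first_def by blast
        then show "z \<in> C n - (\<Union>m<n. C m)"
          using first[OF z(1)] z(2) by blast
      next
        fix z assume z: "z \<in> C n - (\<Union>m<n. C m)"
        then have "first z = n" unfolding first_def
          by (intro Least_equality) (auto simp: not_less[symmetric])
        moreover have "z \<in> topspace X" using z openin_subset[OF C_clopen(1)] by blast
        ultimately show "z \<in> {z \<in> topspace X. first z = n}" by simp
      qed
      moreover have "closedin X (\<Union>m<n. C m)" by (intro closedin_Union) (auto intro: C_clopen)
      ultimately show ?thesis using openin_diff[OF C_clopen(1)] by simp
    qed
    have open_V: "openin X {z \<in> topspace X. u (first z) \<in> A}" for A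
    proof -
      have "{z \<in> topspace X. u (first z) \<in> A} = (\<Union>n\<in>{n. u n \<in> A}. {z \<in> topspace X. first z = n})" by auto
      then show ?thesis by (auto intro!: openin_Union open_first simp del: topspace_product_topology)
    qed
    have V_fun: "functionally_open X (V U)" for U
    proof -
      define ind :: "('i \<Rightarrow> 'b) \<Rightarrow> real" where "ind z = (if u (first z) = U then 1 else 0)" for z
      have "continuous_map X euclideanreal ind"
        unfolding continuous_map_def
      proof (intro conjI allI impI)
        fix A :: "real set"
        have "{z \<in> topspace X. ind z \<in> A} = {z \<in> topspace X. u (first z) \<in> {W. (if W = U then 1 else 0) \<in> A}}"
          by (auto simp: ind_def)
        then show "openin X {z \<in> topspace X. ind z \<in> A}" by (simp only: open_V)
      qed simp
      moreover have "V U = {z \<in> topspace X. ind z \<noteq> 0}" by (auto simp: V_def ind_def)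
      ultimately show ?thesis unfolding functionally_open_def by blast
    qed
    show ?thesis
    proof (intro exI[of _ "V ` \<U>"] conjI)
      show "finite (V ` \<U>)" using \<U> by simp
      show "\<forall>W\<in>V ` \<U>. functionally_open X W" using V_fun by blast
      show "\<Union> (V ` \<U>) = topspace X" using uU by (auto simp: V_def)
      show "\<forall>W\<in>V ` \<U>. \<exists>U\<in>\<U>. W \<subseteq> U"
      proof
        fix W assume "W \<in> V ` \<U>"
        then obtain U where "U \<in> \<U>" "W = V U" by blast
        moreover have "V U \<subseteq> U" using first C_u unfolding V_def by blast
        ultimately show "\<exists>U\<in>\<U>. W \<subseteq> U" by blast
      qed
      show "\<forall>\<W>\<subseteq>V ` \<U>. card \<W> = 0 + 2 \<longrightarrow> \<Inter>\<W> = {}"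
      proof (intro allI impI)
        fix \<W> assume sub: "\<W> \<subseteq> V ` \<U>" and card: "card \<W> = 0 + 2"
        from card have "card \<W> = 2" by simp
        then obtain A B where "\<W> = {A, B}" "A \<noteq> B" unfolding card_2_iff by blast
        with sub have "\<W> = {A, B}" "A \<noteq> B" "A \<in> V ` \<U>" "B \<in> V ` \<U>" by auto
        then show "\<Inter>\<W> = {}" by (auto simp: V_def)
      qed
    qed
  qed
qed

end

lemma countable_base_product_second_countable:
  fixes J :: "'i set"
  assumes "\<And>i. i \<in> J \<Longrightarrow> second_countable (S i)"
  shows "\<exists>\<B>. countable_base_product S J \<B>"
proof -
  have "\<forall>i\<in>J. \<exists>B. countable B \<and> (\<forall>V\<in>B. openin (S i) V) \<and>
      (\<forall>U x. openin (S i) U \<and> x \<in> U \<longrightarrow> (\<exists>V\<in>B. x \<in> V \<and> V \<subseteq> U))"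
    using assms by (auto simp: second_countable_def)
  then obtain \<B> where \<B>: "\<forall>i\<in>J. countable (\<B> i) \<and> (\<forall>V\<in>\<B> i. openin (S i) V) \<and>
      (\<forall>U x. openin (S i) U \<and> x \<in> U \<longrightarrow> (\<exists>V\<in>\<B> i. x \<in> V \<and> V \<subseteq> U))"
    by (rule bchoice[THEN exE])
  then have "countable_base_product S J \<B>"
    by unfold_locales blast+
  then show ?thesis by blast
qed

lemma second_countable_euclidean:
  "second_countable (euclidean :: 'b::second_countable_topology topology)"
proof -
  obtain \<B> :: "'b set set" where \<B>: "countable \<B>" "\<And>C. C \<in> \<B> \<Longrightarrow> open C"
      "\<And>S. open S \<Longrightarrow> \<exists>U. U \<subseteq> \<B> \<and> S = \<Union>U"
    using univ_second_countable by blast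
  have "\<exists>V\<in>\<B>. x \<in> V \<and> V \<subseteq> U" if "open U" "x \<in> U" for U x
    using \<B>(3)[OF that(1)] that(2) by blast
  then show ?thesis unfolding second_countable_def using \<B>(1,2) by (intro exI[of _ \<B>]) auto
qed

lemma countable_base_product_euclidean:
  "\<exists>\<B>. countable_base_product (\<lambda>_::'i. euclidean :: 'b::second_countable_topology topology) UNIV \<B>"
  by (rule countable_base_product_second_countable) (rule second_countable_euclidean)

lemma continuous_on_power_depends_on_countably_many:
  fixes \<phi> :: "('i \<Rightarrow> 'b::second_countable_topology) \<Rightarrow> real"
  assumes "continuous_on UNIV \<phi>"
  shows "\<exists>J. countable J \<and> (\<forall>z w. (\<forall>i\<in>J. z i = w i) \<longrightarrow> \<phi> z = \<phi> w)"
proof -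
  obtain \<B> where "countable_base_product (\<lambda>_::'i. euclidean :: 'b topology) UNIV \<B>"
    using countable_base_product_euclidean by blast
  then interpret countable_base_product "\<lambda>_::'i. euclidean :: 'b topology" UNIV \<B> .
  have "continuous_map X euclideanreal \<phi>"
    using assms by (simp add: euclidean_product_topology)
  from continuous_real_depends_on_countably_many[OF this] show ?thesis
    by auto
qed

lemma borel_measurable_continuous_on_power:
  fixes \<phi> :: "('i \<Rightarrow> 'b::second_countable_topology) \<Rightarrow> real"
  assumes "continuous_on UNIV \<phi>"
  shows "\<phi> \<in> borel_measurable (Pi\<^sub>M UNIV (\<lambda>_. borel))"
proof -
  obtain \<B> where "countable_base_product (\<lambda>_::'i. euclidean :: 'b topology) UNIV \<B>"
    using countable_base_product_euclidean by blast
  then interpret countable_base_product "\<lambda>_::'i. euclidean :: 'b topology" UNIV \<B> .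
  have \<phi>: "continuous_map X euclideanreal \<phi>"
    using assms by (simp add: euclidean_product_topology)
  have "(\<lambda>z. z) \<in> Pi\<^sub>M UNIV (\<lambda>_::'i. borel :: 'b measure) \<rightarrow>\<^sub>M Baire_algebra X"
  proof (rule measurable_product_Baire_algebraI)
    fix i B assume "B \<in> \<B> i"
    then have "B \<in> sets borel" using base_open[of i B] by (simp add: borel_open)
    then show "{x \<in> space (Pi\<^sub>M UNIV (\<lambda>_::'i. borel :: 'b measure)). x i \<in> B} \<in> sets (Pi\<^sub>M UNIV (\<lambda>_. borel))"
      by measurable
  qed auto
  from measurable_compose[OF this borel_measurable_Baire_algebra[OF \<phi>]] show ?thesis by simp
qed

lemma Tychonoff_space_power:
  assumes "Tychonoff_space (euclidean :: 'b::topological_space topology)"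
  shows "Tychonoff_space (euclidean :: ('i \<Rightarrow> 'b) topology)"
proof -
  have "completely_regular_space (product_topology (\<lambda>_::'i. euclidean :: 'b topology) UNIV)"
    using assms by (simp add: Tychonoff_space_def completely_regular_space_product_topology)
  moreover have "Hausdorff_space (product_topology (\<lambda>_::'i. euclidean :: 'b topology) UNIV)"
    using assms by (simp add: Tychonoff_space_def Hausdorff_space_product_topology)
  ultimately show ?thesis
    by (simp add: Tychonoff_space_def euclidean_product_topology)
qed

lemma Tychonoff_space_Baire_space_power:
  "Tychonoff_space (euclidean :: ('i \<Rightarrow> nat \<Rightarrow> nat) topology)"
proof -
  have "discrete_topology UNIV = (euclidean :: nat topology)"
    by (simp add: discrete_topology_unique open_discrete)
  then have "metrizable_space (euclidean :: nat topology)"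
    by (metis metrizable_space_discrete_topology)
  then have "Tychonoff_space (euclidean :: nat topology)"
    by (simp add: Tychonoff_space_def metrizable_imp_completely_regular_space metrizable_imp_Hausdorff_space)
  then show ?thesis by (intro Tychonoff_space_power)
qed

lemma countable_clopen_base_Baire_space:
  "\<exists>K :: (nat \<Rightarrow> nat) set set. countable K \<and> topological_basis K \<and> (\<forall>B\<in>K. closed B)"
proof -
  obtain K :: "(nat \<Rightarrow> nat) set set" where K: "topological_basis K" "countable K"
      "\<forall>k\<in>K. \<exists>X. k = PiE UNIV X \<and> (\<forall>i. open (X i)) \<and> finite {i. X i \<noteq> UNIV}"
    using product_topology_countable_basis by blast
  have "closed B" if B: "B \<in> K" for B
  proof -
    obtain X where X: "B = PiE UNIV X" using K B by blast
    have "B = (\<Inter>i. (\<lambda>z. z i) -` X i)" by (auto simp: X)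
    moreover have "closed ((\<lambda>z::nat \<Rightarrow> nat. z i) -` X i)" for i
      by (rule closed_vimage) (auto simp: closed_def open_discrete)
    ultimately show ?thesis by auto
  qed
  then show ?thesis using K by blast
qed

lemma covering_dim_le_Baire_space_power:
  "covering_dim_le (euclidean :: ('i \<Rightarrow> nat \<Rightarrow> nat) topology) 0"
proof -
  obtain K :: "(nat \<Rightarrow> nat) set set" where K: "countable K" "topological_basis K" "\<forall>B\<in>K. closed B"
    using countable_clopen_base_Baire_space by blast
  interpret countable_base_product "\<lambda>_::'i. euclidean :: (nat \<Rightarrow> nat) topology" UNIV "\<lambda>_. K"
  proof
    show "openin euclidean B" if "B \<in> K" for B
      using topological_basis_open[OF K(2) that] by simp
    show "\<exists>B\<in>K. x \<in> B \<and> B \<subseteq> U" if "openin euclidean U" "x \<in> U" for U x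
      using topological_basisE[OF K(2)] that by (metis open_openin)
  qed (rule K)
  have "covering_dim_le X 0" by (rule covering_dim_le_0) (simp add: K)
  then show ?thesis by (simp add: euclidean_product_topology)
qed

section \<open>A continuous retraction onto an AE(0)-space\<close>

text \<open>Indexing the coordinates by all functions, with a dummy value for the discontinuous ones, makes
  the powers below full function types, whose points need no membership condition.\<close>

definition coordinate :: "'a topology \<Rightarrow> ('a \<Rightarrow> real) \<Rightarrow> 'a \<Rightarrow> real" where
  "coordinate T i = (if continuous_map T euclideanreal i then i else (\<lambda>_. 0))"

lemma continuous_map_coordinate: "continuous_map T euclideanreal (coordinate T i)"
  by (simp add: coordinate_def)

lemma Tychonoff_space_separating_function:
  assumes "Tychonoff_space T" "openin T U" "x \<in> U"
  shows "\<exists>\<psi>. continuous_map T euclideanreal \<psi> \<and> \<psi> x = 0 \<and> (\<forall>y\<in>topspace T - U. \<psi> y = 1)"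
proof -
  have "closedin T (topspace T - U)" "x \<in> topspace T - (topspace T - U)"
    using assms openin_subset[OF assms(2)] by auto
  then obtain \<psi> :: "'a \<Rightarrow> real" where \<psi>: "continuous_map T (top_of_set {0..1}) \<psi>" "\<psi> x = 0"
      "\<psi> ` (topspace T - U) \<subseteq> {1}"
    using assms(1) unfolding Tychonoff_space_def completely_regular_space_def by meson
  have "continuous_map T euclideanreal \<psi>" using \<psi>(1) by (rule continuous_map_into_fulltopology)
  with \<psi>(2,3) show ?thesis by blast
qed

lemma Tychonoff_space_coordinates_separate_points:
  assumes T: "Tychonoff_space T" and xy: "x \<in> topspace T" "y \<in> topspace T"
    and eq: "\<And>i. coordinate T i x = coordinate T i y"
  shows "x = y"
proof (rule ccontr)
  assume "x \<noteq> y"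
  then obtain U V where U: "openin T U" "x \<in> U" "openin T V" "y \<in> V" "disjnt U V"
    using T[unfolded Tychonoff_space_def] xy unfolding Hausdorff_space_def by blast
  obtain \<psi> where \<psi>: "continuous_map T euclideanreal \<psi>" "\<psi> x = 0" "\<forall>y\<in>topspace T - U. \<psi> y = 1"
    using Tychonoff_space_separating_function[OF T U(1,2)] by blast
  have "\<psi> y = 1" using \<psi>(3) U xy by (auto simp: disjnt_def)
  then show False using eq[of \<psi>] \<psi> by (simp add: coordinate_def)
qed

text \<open>The evaluation map embeds \<open>T\<close> in a power of the reals. Test the extension property with
  the power \<open>Z\<close> of the Baire space over this power of the reals, the part \<open>Z\<^sub>0\<close> of \<open>Z\<close> over \<open>T\<close> and
  the projection \<open>f\<close> of \<open>Z\<^sub>0\<close> to \<open>T\<close>: each \<open>\<psi> \<circ> f\<close> is the restriction of the coordinate \<open>\<psi>\<close>.\<close>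

theorem AE0_space_retraction:
  fixes T :: "'a topology"
  assumes T: "AE0_space T"
  shows "\<exists>g. continuous_map euclidean T g \<and>
    (\<forall>x\<in>topspace T. \<forall>z. limits z = (\<lambda>i. coordinate T i x) \<longrightarrow> g z = x)"
proof -
  have Ty: "Tychonoff_space T" using T by (simp add: AE0_space_def)
  define e where "e x = (\<lambda>i. coordinate T i x)" for x
  define Z\<^sub>0 :: "(('a \<Rightarrow> real) \<Rightarrow> nat \<Rightarrow> nat) set" where "Z\<^sub>0 = {z. limits z \<in> e ` topspace T}"
  define f where "f z = (THE x. x \<in> topspace T \<and> limits z = e x)" for z
  have f: "f z = x" if "x \<in> topspace T" "limits z = e x" for x z
    unfolding f_def
  proof (rule the_equality)
    fix y assume "y \<in> topspace T \<and> limits z = e y"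
    then show "y = x"
      using that by (intro Tychonoff_space_coordinates_separate_points[OF Ty]) (auto simp: e_def fun_eq_iff)
  qed (use that in simp)
  have f_in: "f z \<in> topspace T" "limits z = e (f z)" if "z \<in> Z\<^sub>0" for z
  proof -
    obtain x where x: "x \<in> topspace T" "limits z = e x"
      using \<open>z \<in> Z\<^sub>0\<close> unfolding Z\<^sub>0_def by blast
    then show "f z \<in> topspace T" "limits z = e (f z)" using f[OF x] by simp_all
  qed
  have lim_cont: "continuous_map euclidean euclideanreal (\<lambda>z::('a \<Rightarrow> real) \<Rightarrow> nat \<Rightarrow> nat. limits z i)" for i
    using continuous_on_limits_coordinate[of i] by simp
  have ext: "extension_property (euclidean :: (('a \<Rightarrow> real) \<Rightarrow> nat \<Rightarrow> nat) topology) T"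
    by (rule T[unfolded AE0_space_def, THEN conjunct2, rule_format])
       (intro conjI Tychonoff_space_Baire_space_power covering_dim_le_Baire_space_power)
  have cont: "continuous_map (subtopology euclidean Z\<^sub>0) T f"
    unfolding continuous_map_def
  proof (intro conjI allI impI)
    show "f \<in> topspace (subtopology euclidean Z\<^sub>0) \<rightarrow> topspace T" using f_in by auto
    fix U assume U: "openin T U"
    show "openin (subtopology euclidean Z\<^sub>0) {z \<in> topspace (subtopology euclidean Z\<^sub>0). f z \<in> U}"
    proof (subst openin_subopen, intro ballI)
      fix z assume "z \<in> {z \<in> topspace (subtopology euclidean Z\<^sub>0). f z \<in> U}"
      then have z: "z \<in> Z\<^sub>0" "f z \<in> U" by auto
      obtain \<psi> where \<psi>: "continuous_map T euclideanreal \<psi>" "\<psi> (f z) = 0" "\<forall>y\<in>topspace T - U. \<psi> y = 1"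
        using Tychonoff_space_separating_function[OF Ty U z(2)] by blast
      have lim: "limits w \<psi> = \<psi> (f w)" if "w \<in> Z\<^sub>0" for w
        using f_in(2)[OF that] \<psi>(1) by (simp add: e_def coordinate_def)
      have "open {w. limits w \<psi> < 1}"
        using openin_continuous_map_preimage[OF lim_cont[of \<psi>], of "{..<1}"] by simp
      then have "openin (subtopology euclidean Z\<^sub>0) (Z\<^sub>0 \<inter> {w. limits w \<psi> < 1})"
        by (rule openin_open_Int)
      moreover have "z \<in> Z\<^sub>0 \<inter> {w. limits w \<psi> < 1}" using z lim \<psi> by simp
      moreover have "Z\<^sub>0 \<inter> {w. limits w \<psi> < 1} \<subseteq> {z \<in> topspace (subtopology euclidean Z\<^sub>0). f z \<in> U}"
      proof
        fix w assume w: "w \<in> Z\<^sub>0 \<inter> {w. limits w \<psi> < 1}"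
        then have "f w \<in> U" using lim[of w] \<psi>(3) f_in[of w] by force
        then show "w \<in> {z \<in> topspace (subtopology euclidean Z\<^sub>0). f z \<in> U}" using w by simp
      qed
      ultimately show "\<exists>W. openin (subtopology euclidean Z\<^sub>0) W \<and> z \<in> W \<and>
          W \<subseteq> {z \<in> topspace (subtopology euclidean Z\<^sub>0). f z \<in> U}" by blast
    qed
  qed
  have "\<exists>\<phi>. continuous_map euclidean euclideanreal \<phi> \<and> (\<forall>z\<in>Z\<^sub>0. \<phi> z = \<psi> (f z))"
    if "continuous_map T euclideanreal \<psi>" for \<psi>
  proof (intro exI conjI ballI)
    show "continuous_map euclidean euclideanreal (\<lambda>z. limits z \<psi>)" by (rule lim_cont)
    show "limits z \<psi> = \<psi> (f z)" if "z \<in> Z\<^sub>0" for z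
      using f_in(2)[OF that] \<open>continuous_map T euclideanreal \<psi>\<close> by (simp add: e_def coordinate_def)
  qed
  with ext cont obtain g where g: "continuous_map euclidean T g" "\<forall>z\<in>Z\<^sub>0. g z = f z"
    unfolding extension_property_def by (metis subset_UNIV topspace_euclidean)
  have "g z = x" if "x \<in> topspace T" "limits z = (\<lambda>i. coordinate T i x)" for x z
  proof -
    have "limits z = e x" using that by (simp add: e_def)
    then have "z \<in> Z\<^sub>0" "f z = x" using f that by (auto simp: Z\<^sub>0_def)
    then show ?thesis using g by simp
  qed
  with g(1) show ?thesis by blast
qed

section \<open>Coordinates on a retracted topological group\<close>

text \<open>All that is used of an \<open>AE(0)\<close>-group: composing \<open>g\<close> with a section of \<open>limits\<close> gives a retraction of
  the power of the reals onto the group, embedded by its coordinates.\<close>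

locale retracted_group = group G for G :: "('a, 'm) monoid_scheme" (structure) +
  fixes T :: "'a topology" and g :: "(('a \<Rightarrow> real) \<Rightarrow> nat \<Rightarrow> nat) \<Rightarrow> 'a"
  assumes topological_group: "topological_group G T"
    and continuous_g: "continuous_map euclidean T g"
    and g_retracts: "x \<in> carrier G \<Longrightarrow> limits z = (\<lambda>i. coordinate T i x) \<Longrightarrow> g z = x"
begin

abbreviation co :: "('a \<Rightarrow> real) \<Rightarrow> 'a \<Rightarrow> real" where "co \<equiv> coordinate T"

abbreviation coords :: "'a \<Rightarrow> ('a \<Rightarrow> real) \<Rightarrow> real" where "coords x \<equiv> (\<lambda>i. co i x)"

abbreviation quot :: "'a \<Rightarrow> 'a \<Rightarrow> 'a" where "quot x y \<equiv> x \<otimes> inv y"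

abbreviation retr_at :: "(('a \<Rightarrow> real) \<Rightarrow> real) \<Rightarrow> (('a \<Rightarrow> real) \<Rightarrow> real) \<Rightarrow> 'a"
  where "retr_at b t \<equiv> g (lifts b t)"

abbreviation retr :: "(('a \<Rightarrow> real) \<Rightarrow> real) \<Rightarrow> 'a" where "retr \<equiv> retr_at (\<lambda>_. 0)"

lemma topspace_T [simp]: "topspace T = carrier G"
  using topological_group by (simp add: topological_group_def)

lemma g_closed [simp]: "g z \<in> carrier G"
  using continuous_map_image_subset_topspace[OF continuous_g] by auto

lemma retr_at_coords [simp]: "x \<in> carrier G \<Longrightarrow> retr_at b (coords x) = x"
  by (rule g_retracts) auto

lemma eqI_coordinates:
  assumes "x \<in> carrier G" "y \<in> carrier G" "\<And>i. co i x = co i y"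
  shows "x = y"
proof -
  have "coords x = coords y" using assms(3) by blast
  then show ?thesis using retr_at_coords[OF assms(1)] retr_at_coords[OF assms(2)] by metis
qed

lemma continuous_map_quot: "continuous_map (prod_topology T T) T (\<lambda>(x, y). quot x y)"
proof -
  have m: "continuous_map (prod_topology T T) T (\<lambda>(x, y). x \<otimes> y)"
    and i: "continuous_map T T (\<lambda>x. inv x)"
    using topological_group by (auto simp: topological_group_def)
  have "continuous_map (prod_topology T T) (prod_topology T T) (\<lambda>(x, y). (x, inv y))"
    using continuous_map_prod_top[of T T T T "\<lambda>x. x" "\<lambda>x. inv x"] i by simp
  from continuous_map_compose[OF this m] show ?thesis
    by (simp add: o_def case_prod_unfold)
qed

text \<open>Division determines all group operations, so only its coordinates are tracked. Composing
  with \<open>g\<close> turns them into continuous functions on a power of a second countable space, to which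
  the countable dependence theorem applies.\<close>

definition quot_coord ::
    "('a \<Rightarrow> real) \<Rightarrow> (('a \<Rightarrow> real) \<Rightarrow> nat \<Rightarrow> nat) \<Rightarrow> (('a \<Rightarrow> real) \<Rightarrow> nat \<Rightarrow> nat) \<Rightarrow> real" where
  "quot_coord a z w = co a (quot (g z) (g w))"

lemma continuous_on_quot_coord:
  "continuous_on UNIV (\<lambda>v. quot_coord a (\<lambda>i. fst (v i)) (\<lambda>i. snd (v i)))"
proof -
  have f: "continuous_map euclidean euclidean (\<lambda>v (i :: 'a \<Rightarrow> real). fst (v i :: (nat \<Rightarrow> nat) \<times> (nat \<Rightarrow> nat)))"
    unfolding continuous_map_iff_continuous2
    by (intro continuous_on_coordinatewise_then_product continuous_on_fst) simp
  have s: "continuous_map euclidean euclidean (\<lambda>v (i :: 'a \<Rightarrow> real). snd (v i :: (nat \<Rightarrow> nat) \<times> (nat \<Rightarrow> nat)))"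
    unfolding continuous_map_iff_continuous2
    by (intro continuous_on_coordinatewise_then_product continuous_on_snd) simp
  have "continuous_map euclidean (prod_topology T T)
      (\<lambda>v. (g (\<lambda>i. fst (v i)), g (\<lambda>i. snd (v i))))"
    using continuous_map_compose[OF f continuous_g] continuous_map_compose[OF s continuous_g]
    by (simp add: continuous_map_pairwise o_def)
  from continuous_map_compose[OF continuous_map_compose[OF this continuous_map_quot] continuous_map_coordinate[of T a]]
  show ?thesis by (simp add: quot_coord_def o_def)
qed

lemma tendsto_quot_coord:
  assumes t: "\<And>i. ((\<lambda>k. t k i) \<longlongrightarrow> t0 i) F" and s: "\<And>i. ((\<lambda>k. s k i) \<longlongrightarrow> s0 i) F"
  shows "((\<lambda>k. quot_coord a (lifts t0 (t k)) (lifts s0 (s k))) \<longlongrightarrow>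
    quot_coord a (lifts t0 t0) (lifts s0 s0)) F"
proof -
  have "((\<lambda>k i. (lifts t0 (t k) i, lifts s0 (s k) i)) \<longlongrightarrow> (\<lambda>i. (lifts t0 t0 i, lifts s0 s0 i))) F"
    by (rule tendsto_coordinatewise) (intro tendsto_Pair tendsto_lifts t s)
  from continuous_on_tendsto_compose[OF continuous_on_quot_coord[of a] this] show ?thesis
    by simp
qed

subsection \<open>Autonomous sets of coordinates\<close>

text \<open>On an autonomous set \<open>A\<close>, the coordinates of a quotient of retracted points depend on their
  arguments through \<open>A\<close> only. So equality of the coordinates in \<open>A\<close> is a congruence of the group,
  and the projection of the group to these coordinates is again a retract.\<close>

definition autonomous :: "('a \<Rightarrow> real) set \<Rightarrow> bool" where
  "autonomous A \<longleftrightarrow> (\<forall>z z' w w'. (\<forall>i\<in>A. z i = z' i \<and> w i = w' i) \<longrightarrow>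
     (\<forall>a\<in>A. quot_coord a z w = quot_coord a z' w'))"

lemma autonomousD:
  assumes "autonomous A" "\<And>i. i \<in> A \<Longrightarrow> z i = z' i" "\<And>i. i \<in> A \<Longrightarrow> w i = w' i" "a \<in> A"
  shows "quot_coord a z w = quot_coord a z' w'"
  using assms unfolding autonomous_def by blast

lemma autonomous_Union:
  assumes "\<And>A. A \<in> \<A> \<Longrightarrow> autonomous A" shows "autonomous (\<Union>\<A>)"
  unfolding autonomous_def
proof (intro allI impI ballI)
  fix z z' w w' :: "('a \<Rightarrow> real) \<Rightarrow> nat \<Rightarrow> nat" and a
  assume eq: "\<forall>i\<in>\<Union>\<A>. z i = z' i \<and> w i = w' i" and "a \<in> \<Union>\<A>"
  then obtain A where "A \<in> \<A>" "a \<in> A" by blast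
  then show "quot_coord a z w = quot_coord a z' w'"
    using eq assms by (intro autonomousD[of A]) auto
qed

text \<open>Close \<open>{a}\<close> under passing from a coordinate to the countably many on which it depends.\<close>

theorem countable_autonomous_set: "\<exists>A. countable A \<and> a \<in> A \<and> autonomous A"
proof -
  have "\<exists>D. countable D \<and> (\<forall>z z' w w'. (\<forall>i\<in>D. z i = z' i \<and> w i = w' i) \<longrightarrow>
      quot_coord a z w = quot_coord a z' w')" for a
  proof -
    obtain D where D: "countable D" and dep: "\<forall>v v'. (\<forall>i\<in>D. v i = v' i) \<longrightarrow>
        quot_coord a (\<lambda>i. fst (v i)) (\<lambda>i. snd (v i)) = quot_coord a (\<lambda>i. fst (v' i)) (\<lambda>i. snd (v' i))"
      using continuous_on_power_depends_on_countably_many[OF continuous_on_quot_coord[of a]] by blast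
    have "quot_coord a z w = quot_coord a z' w'" if "\<forall>i\<in>D. z i = z' i \<and> w i = w' i" for z z' w w'
      using dep[rule_format, of "\<lambda>i. (z i, w i)" "\<lambda>i. (z' i, w' i)"] that by simp
    with D show ?thesis by blast
  qed
  then obtain D where D: "\<And>a. countable (D a)"
    and dep: "\<And>a z z' w w'. (\<forall>i\<in>D a. z i = z' i \<and> w i = w' i) \<Longrightarrow> quot_coord a z w = quot_coord a z' w'"
    by metis
  define A where "A = {(a, b). b \<in> D a}\<^sup>* `` {a}"
  have "countable A"
    unfolding A_def
  proof (rule countable_rtrancl)
    fix Y :: "('a \<Rightarrow> real) set" assume "countable Y"
    moreover have "{(a, b). b \<in> D a} `` Y = (\<Union>a\<in>Y. D a)" by auto
    ultimately show "countable ({(a, b). b \<in> D a} `` Y)" using D by simp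
  qed simp
  moreover have "a \<in> A" by (auto simp: A_def)
  moreover have "autonomous A"
    unfolding autonomous_def
  proof (intro allI impI ballI)
    fix z z' w w' :: "('a \<Rightarrow> real) \<Rightarrow> nat \<Rightarrow> nat" and b
    assume eq: "\<forall>i\<in>A. z i = z' i \<and> w i = w' i" and b: "b \<in> A"
    have "D b \<subseteq> A" using b by (auto simp: A_def intro: rtrancl_into_rtrancl)
    then show "quot_coord b z w = quot_coord b z' w'" using eq by (intro dep) blast
  qed
  ultimately show ?thesis by blast
qed

definition agree :: "('a \<Rightarrow> real) set \<Rightarrow> 'a \<Rightarrow> 'a \<Rightarrow> bool" where
  "agree A x y \<longleftrightarrow> (\<forall>a\<in>A. co a x = co a y)"

lemma agree_refl [simp]: "agree A x x"
  by (simp add: agree_def)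

lemma agree_sym: "agree A x y \<Longrightarrow> agree A y x"
  by (simp add: agree_def)

lemma agree_trans: "agree A x y \<Longrightarrow> agree A y z \<Longrightarrow> agree A x z"
  by (simp add: agree_def)

lemma agree_subset: "agree A x y \<Longrightarrow> B \<subseteq> A \<Longrightarrow> agree B x y"
  by (auto simp: agree_def)

lemma agree_quot:
  assumes "autonomous A" "agree A x x'" "agree A y y'"
    and "x \<in> carrier G" "x' \<in> carrier G" "y \<in> carrier G" "y' \<in> carrier G"
  shows "agree A (quot x y) (quot x' y')"
  unfolding agree_def
proof
  fix a assume a: "a \<in> A"
  have "quot_coord a (lifts (\<lambda>_. 0) (coords x)) (lifts (\<lambda>_. 0) (coords y)) =
      quot_coord a (lifts (\<lambda>_. 0) (coords x')) (lifts (\<lambda>_. 0) (coords y'))"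
    using assms a by (intro autonomousD[of A]) (auto simp: agree_def lifts_def)
  then show "co a (quot x y) = co a (quot x' y')"
    using assms by (simp add: quot_coord_def)
qed

lemma agree_inv:
  assumes "autonomous A" "agree A y y'" "y \<in> carrier G" "y' \<in> carrier G"
  shows "agree A (inv y) (inv y')"
  using agree_quot[of A \<one> \<one> y y'] assms by simp

lemma agree_mult:
  assumes "autonomous A" "agree A x x'" "agree A y y'"
    and "x \<in> carrier G" "x' \<in> carrier G" "y \<in> carrier G" "y' \<in> carrier G"
  shows "agree A (x \<otimes> y) (x' \<otimes> y')"
  using agree_quot[of A x x' "inv y" "inv y'"] agree_inv[of A y y'] assms by simp

text \<open>Every point of the power of the reals that looks like \<open>x\<close> on an autonomous set is retracted to a point
  that still looks like \<open>x\<close> there. This provides sections and gluing.\<close>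

lemma agree_retr_at:
  assumes A: "autonomous A" and x: "x \<in> carrier G" and t: "\<And>a. a \<in> A \<Longrightarrow> t a = co a x"
  shows "agree A (retr_at b t) x"
  unfolding agree_def
proof
  fix a assume a: "a \<in> A"
  have "quot_coord a (lifts b t) (lifts b (coords \<one>)) = quot_coord a (lifts b (coords x)) (lifts b (coords \<one>))"
    using t by (intro autonomousD[OF A _ _ a]) (auto simp: lifts_def)
  then show "co a (retr_at b t) = co a x"
    using x by (simp add: quot_coord_def)
qed

subsection \<open>Measurability of the group operations\<close>

text \<open>The coordinates generate the Baire sets, since every continuous function is a coordinate.\<close>

lemma measurable_Baire_coordinates_iff:
  "u \<in> M \<rightarrow>\<^sub>M Baire_algebra T \<longleftrightarrow>
     u \<in> space M \<rightarrow> carrier G \<and> (\<forall>a. (\<lambda>x. co a (u x)) \<in> borel_measurable M)"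
  unfolding measurable_Baire_algebra_iff
  by (auto simp: coordinate_def)

lemma measurable_retr:
  assumes "\<And>a. (\<lambda>x. t x a) \<in> borel_measurable M"
  shows "(\<lambda>x. retr (t x)) \<in> M \<rightarrow>\<^sub>M Baire_algebra T"
  unfolding measurable_Baire_coordinates_iff
proof (intro conjI allI)
  fix a
  have "continuous_on UNIV (\<lambda>z. co a (g z))"
    using continuous_map_compose[OF continuous_g continuous_map_coordinate[of T a]] by (simp add: o_def)
  from measurable_compose[OF measurable_lifts[OF assms] borel_measurable_continuous_on_power[OF this]]
  show "(\<lambda>x. co a (retr (t x))) \<in> borel_measurable M" .
qed auto

text \<open>Joint measurability is not automatic, because the Baire sets of a square may exceed the product
  of the Baire algebras; it holds because division lifts to a power of the Baire space.\<close>

lemma measurable_quot: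
  assumes u: "u \<in> M \<rightarrow>\<^sub>M Baire_algebra T" and v: "v \<in> M \<rightarrow>\<^sub>M Baire_algebra T"
  shows "(\<lambda>x. quot (u x) (v x)) \<in> M \<rightarrow>\<^sub>M Baire_algebra T"
  unfolding measurable_Baire_coordinates_iff
proof (intro conjI allI)
  have uv: "u x \<in> carrier G" "v x \<in> carrier G" if "x \<in> space M" for x
    using u v that unfolding measurable_Baire_coordinates_iff by auto
  then show "(\<lambda>x. quot (u x) (v x)) \<in> space M \<rightarrow> carrier G" by auto
  fix a
  have lift: "(\<lambda>x. lifts (\<lambda>_. 0) (coords (w x))) \<in> M \<rightarrow>\<^sub>M Pi\<^sub>M UNIV (\<lambda>_. borel)"
    if "w \<in> M \<rightarrow>\<^sub>M Baire_algebra T" for w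
    using that unfolding measurable_Baire_coordinates_iff by (intro measurable_lifts) blast
  have "(\<lambda>x i. (lifts (\<lambda>_. 0) (coords (u x)) i, lifts (\<lambda>_. 0) (coords (v x)) i)) \<in> M \<rightarrow>\<^sub>M Pi\<^sub>M UNIV (\<lambda>_. borel)"
    using measurable_component_singleton[of _ UNIV "\<lambda>_. borel", THEN measurable_compose[OF lift[OF u]]]
      measurable_component_singleton[of _ UNIV "\<lambda>_. borel", THEN measurable_compose[OF lift[OF v]]]
    by (intro measurable_PiM_single') (auto intro!: borel_measurable_Pair)
  from measurable_compose[OF this borel_measurable_continuous_on_power[OF continuous_on_quot_coord[of a]]]
  have "(\<lambda>x. quot_coord a (lifts (\<lambda>_. 0) (coords (u x))) (lifts (\<lambda>_. 0) (coords (v x)))) \<in> borel_measurable M"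
    by simp
  then show "(\<lambda>x. co a (quot (u x) (v x))) \<in> borel_measurable M"
    by (rule measurable_cong[THEN iffD1, rotated]) (simp add: quot_coord_def uv)
qed

lemma measurable_mult:
  assumes u: "u \<in> M \<rightarrow>\<^sub>M Baire_algebra T" and v: "v \<in> M \<rightarrow>\<^sub>M Baire_algebra T"
  shows "(\<lambda>x. u x \<otimes> v x) \<in> M \<rightarrow>\<^sub>M Baire_algebra T"
proof -
  have one: "(\<lambda>_. \<one>) \<in> M \<rightarrow>\<^sub>M Baire_algebra T" by (intro measurable_const) simp
  have "(\<lambda>x. quot (u x) (quot \<one> (v x))) \<in> M \<rightarrow>\<^sub>M Baire_algebra T"
    by (intro measurable_quot u v one)
  then show ?thesis
    by (rule measurable_cong[THEN iffD1, rotated])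
       (use measurable_space[OF u] measurable_space[OF v] in simp)
qed

end

section \<open>Splitting the group into Polish kernels\<close>

text \<open>Inversion is \<open>\<one> / y\<close> and multiplication is \<open>x / (\<one> / y)\<close>.\<close>

lemma topological_groupI_quotient:
  assumes G: "group G" and top: "topspace T = carrier G"
    and q: "continuous_map (prod_topology T T) T (\<lambda>(x, y). x \<otimes>\<^bsub>G\<^esub> inv\<^bsub>G\<^esub> y)"
  shows "topological_group G T"
proof -
  interpret group G by fact
  have "continuous_map T (prod_topology T T) (\<lambda>y. (\<one>\<^bsub>G\<^esub>, y))"
    by (auto simp: continuous_map_pairwise o_def top)
  from continuous_map_compose[OF this q] have "continuous_map T T (\<lambda>y. \<one>\<^bsub>G\<^esub> \<otimes>\<^bsub>G\<^esub> inv\<^bsub>G\<^esub> y)"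
    by (simp add: o_def)
  then have i: "continuous_map T T (\<lambda>y. inv\<^bsub>G\<^esub> y)"
    by (rule continuous_map_eq) (simp add: top)
  have "continuous_map (prod_topology T T) (prod_topology T T) (\<lambda>(x, y). (x, inv\<^bsub>G\<^esub> y))"
    using continuous_map_prod_top[of T T T T "\<lambda>x. x" "\<lambda>y. inv\<^bsub>G\<^esub> y"] i by simp
  from continuous_map_compose[OF this q]
  have "continuous_map (prod_topology T T) T (\<lambda>(x, y). x \<otimes>\<^bsub>G\<^esub> inv\<^bsub>G\<^esub> (inv\<^bsub>G\<^esub> y))"
    by (simp add: o_def case_prod_unfold)
  then have "continuous_map (prod_topology T T) T (\<lambda>(x, y). x \<otimes>\<^bsub>G\<^esub> y)"
    by (rule continuous_map_eq) (auto simp: top)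
  with i G top show ?thesis by (simp add: topological_group_def)
qed

text \<open>A well-ordering \<open>R\<close> of the coordinates, with a countable autonomous set \<open>cl i\<close> around each
  coordinate \<open>i\<close>, exhausts the coordinates by an increasing chain of autonomous sets that grows by
  countably many coordinates at each step.\<close>

locale autonomous_filtration = retracted_group G T g
  for G :: "('a, 'm) monoid_scheme" (structure) and T g +
  fixes cl :: "('a \<Rightarrow> real) \<Rightarrow> ('a \<Rightarrow> real) set" and R :: "(('a \<Rightarrow> real) \<times> ('a \<Rightarrow> real)) set"
  assumes autonomous_cl: "autonomous (cl i)"
    and countable_cl: "countable (cl i)"
    and mem_cl: "i \<in> cl i"
    and wf_R: "wf R"
    and trans_R: "trans R"
    and total_R: "i \<noteq> j \<Longrightarrow> (i, j) \<in> R \<or> (j, i) \<in> R"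
begin

definition before :: "('a \<Rightarrow> real) \<Rightarrow> ('a \<Rightarrow> real) set" where
  "before i = \<Union>(cl ` {j. (j, i) \<in> R})"

definition upto :: "('a \<Rightarrow> real) \<Rightarrow> ('a \<Rightarrow> real) set" where
  "upto i = before i \<union> cl i"

lemma autonomous_before: "autonomous (before i)"
  unfolding before_def by (rule autonomous_Union) (auto simp: autonomous_cl)

lemma autonomous_upto: "autonomous (upto i)"
proof -
  have "upto i = \<Union>{before i, cl i}" by (auto simp: upto_def)
  then show ?thesis
    using autonomous_Union[of "{before i, cl i}"] autonomous_before autonomous_cl by auto
qed

lemma upto_subset_before: assumes "(j, i) \<in> R" shows "upto j \<subseteq> before i"
  using assms trans_R unfolding upto_def before_def by (auto dest: transD)

lemma before_subset_Un_upto: "a \<in> before i \<Longrightarrow> \<exists>j. (j, i) \<in> R \<and> a \<in> upto j"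
  unfolding upto_def before_def by auto

text \<open>For each initial part of the chain this is a section of the projection of the group to the
  coordinates in that part: pad with zeros and retract.\<close>

definition section_at :: "('a \<Rightarrow> real) \<Rightarrow> (('a \<Rightarrow> real) \<Rightarrow> real) \<Rightarrow> 'a" where
  "section_at i t = retr (\<lambda>a. if a \<in> before i then t a else 0)"

lemma section_at_closed [simp]: "section_at i t \<in> carrier G"
  by (simp add: section_at_def)

lemma agree_section_at:
  assumes "x \<in> carrier G" "\<And>a. a \<in> before i \<Longrightarrow> t a = co a x"
  shows "agree (before i) (section_at i t) x"
  unfolding section_at_def using assms by (intro agree_retr_at autonomous_before) auto

lemma section_at_cong:
  "(\<And>a. a \<in> before i \<Longrightarrow> t a = s a) \<Longrightarrow> section_at i t = section_at i s"
  unfolding section_at_def by (rule arg_cong[where f = retr]) auto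

text \<open>The kernel of the \<open>i\<close>-th step, before identifying elements that agree on \<open>upto i\<close>. Its elements
  are then determined by their coordinates in the countable set \<open>cl i\<close>, which \<open>code\<close> lists.\<close>

definition kernel_at :: "('a \<Rightarrow> real) \<Rightarrow> 'a set" where
  "kernel_at i = {y \<in> carrier G. agree (before i) y \<one>}"

definition code :: "('a \<Rightarrow> real) \<Rightarrow> 'a \<Rightarrow> nat \<Rightarrow> real" where
  "code i y = (\<lambda>n. co (from_nat_into (cl i) n) y)"

text \<open>The coordinates on \<open>upto i\<close> of the elements of the kernel with a given code, zero elsewhere.\<close>

definition decode :: "('a \<Rightarrow> real) \<Rightarrow> (nat \<Rightarrow> real) \<Rightarrow> ('a \<Rightarrow> real) \<Rightarrow> real" where
  "decode i k = (\<lambda>a. if a \<in> before i then co a \<one> else if a \<in> cl i then k (to_nat_on (cl i) a) else 0)"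

definition factor :: "('a \<Rightarrow> real) \<Rightarrow> (nat \<Rightarrow> real) set" where
  "factor i = code i ` kernel_at i"

lemma from_nat_into_cl: "from_nat_into (cl i) n \<in> cl i"
  using mem_cl by (intro from_nat_into) blast

lemma code_eq_iff: "code i x = code i y \<longleftrightarrow> agree (cl i) x y"
proof
  assume eq: "code i x = code i y"
  show "agree (cl i) x y"
    unfolding agree_def
  proof
    fix a assume "a \<in> cl i"
    then have "from_nat_into (cl i) (to_nat_on (cl i) a) = a"
      using countable_cl by (rule from_nat_into_to_nat_on[rotated])
    then show "co a x = co a y" using fun_cong[OF eq, of "to_nat_on (cl i) a"] by (simp add: code_def)
  qed
next
  assume "agree (cl i) x y"
  then show "code i x = code i y" using from_nat_into_cl by (auto simp: code_def agree_def)
qed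

lemma kernel_at_closed: "y \<in> kernel_at i \<Longrightarrow> y \<in> carrier G"
  by (simp add: kernel_at_def)

lemma decode_code:
  assumes y: "y \<in> kernel_at i" and a: "a \<in> upto i"
  shows "decode i (code i y) a = co a y"
proof (cases "a \<in> before i")
  case True
  then have "co a y = co a \<one>" using y unfolding kernel_at_def agree_def by blast
  then show ?thesis using True by (simp add: decode_def)
next
  case False
  then have "a \<in> cl i" using a by (simp add: upto_def)
  then have "from_nat_into (cl i) (to_nat_on (cl i) a) = a"
    using countable_cl by (rule from_nat_into_to_nat_on[rotated])
  then show ?thesis using False \<open>a \<in> cl i\<close> by (simp add: decode_def code_def)
qed

lemma agree_retr_decode:
  assumes y: "y \<in> kernel_at i" shows "agree (upto i) (retr_at b (decode i (code i y))) y"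
  by (rule agree_retr_at[OF autonomous_upto kernel_at_closed[OF y] decode_code[OF y]])

lemma subgroup_kernel_at: "subgroup (kernel_at i) G"
proof (rule subgroupI)
  show "kernel_at i \<subseteq> carrier G" by (auto simp: kernel_at_def)
  have "\<one> \<in> kernel_at i" by (simp add: kernel_at_def)
  then show "kernel_at i \<noteq> {}" by blast
  show "inv y \<in> kernel_at i" if "y \<in> kernel_at i" for y
    using that agree_inv[OF autonomous_before, of i y \<one>] by (simp add: kernel_at_def)
  show "x \<otimes> y \<in> kernel_at i" if "x \<in> kernel_at i" "y \<in> kernel_at i" for x y
    using that agree_mult[OF autonomous_before, of i x \<one> y \<one>] by (simp add: kernel_at_def)
qed

lemma code_retr_decode:
  assumes y: "y \<in> kernel_at i" shows "code i (retr_at b (decode i (code i y))) = code i y"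
  unfolding code_eq_iff using agree_retr_decode[OF y] by (rule agree_subset) (simp add: upto_def)

definition factor_group :: "('a \<Rightarrow> real) \<Rightarrow> (nat \<Rightarrow> real) monoid" where
  "factor_group i = \<lparr>carrier = factor i,
     mult = (\<lambda>k l. code i (retr (decode i k) \<otimes> retr (decode i l))), one = code i \<one>\<rparr>"

definition factor_topology :: "('a \<Rightarrow> real) \<Rightarrow> (nat \<Rightarrow> real) topology" where
  "factor_topology i = subtopology euclidean (factor i)"

lemma topspace_factor_topology [simp]: "topspace (factor_topology i) = factor i"
  by (simp add: factor_topology_def)

lemma code_mult:
  assumes "x \<in> kernel_at i" "y \<in> kernel_at i"
  shows "code i (x \<otimes> y) = code i x \<otimes>\<^bsub>factor_group i\<^esub> code i y"
proof -
  have "agree (cl i) (x \<otimes> y) (retr (decode i (code i x)) \<otimes> retr (decode i (code i y)))"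
    using assms code_retr_decode[OF assms(1), of "\<lambda>_. 0"] code_retr_decode[OF assms(2), of "\<lambda>_. 0"]
    by (intro agree_mult autonomous_cl) (auto simp: code_eq_iff intro: agree_sym kernel_at_closed)
  then show ?thesis by (simp add: factor_group_def code_eq_iff)
qed

lemma group_hom_code: "group_hom (G\<lparr>carrier := kernel_at i\<rparr>) (factor_group i) (code i)"
proof -
  interpret N: group "G\<lparr>carrier := kernel_at i\<rparr>"
    using subgroup.subgroup_is_group[OF subgroup_kernel_at] group_axioms .
  have hom: "code i \<in> hom (G\<lparr>carrier := kernel_at i\<rparr>) (factor_group i)"
    using code_mult by (auto simp: hom_def factor_group_def factor_def)
  have "group (factor_group i \<lparr>carrier := code i ` kernel_at i, one := code i \<one>\<rparr>)"
    using N.hom_imp_img_group[OF hom] by simp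
  moreover have "factor_group i \<lparr>carrier := code i ` kernel_at i, one := code i \<one>\<rparr> = factor_group i"
    by (simp add: factor_group_def factor_def)
  ultimately have "group (factor_group i)" by simp
  then show ?thesis
    using hom N.group_axioms by (simp add: group_hom_def group_hom_axioms_def)
qed

lemma quot_factor_group:
  assumes "x \<in> kernel_at i" "y \<in> kernel_at i"
  shows "code i x \<otimes>\<^bsub>factor_group i\<^esub> inv\<^bsub>factor_group i\<^esub> (code i y) = code i (quot x y)"
proof -
  interpret h: group_hom "G\<lparr>carrier := kernel_at i\<rparr>" "factor_group i" "code i"
    by (rule group_hom_code)
  have inv: "inv y \<in> kernel_at i" using subgroup.m_inv_closed[OF subgroup_kernel_at assms(2)] .
  have "inv\<^bsub>G\<lparr>carrier := kernel_at i\<rparr>\<^esub> y = inv y"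
    using m_inv_consistent[OF subgroup_kernel_at assms(2)] .
  then have "code i (inv y) = inv\<^bsub>factor_group i\<^esub> (code i y)"
    using h.hom_inv[of y] assms(2) by simp
  then show ?thesis using code_mult[OF assms(1) inv] by simp
qed

lemma tendsto_decode:
  assumes "(f \<longlongrightarrow> k0) F" shows "((\<lambda>k. decode i (f k) a) \<longlongrightarrow> decode i k0 a) F"
proof -
  have "((\<lambda>k. f k n) \<longlongrightarrow> k0 n) F" for n
    using continuous_on_tendsto_compose[OF continuous_on_product_coordinates[of n] assms] by simp
  then show ?thesis by (auto simp: decode_def)
qed

lemma quot_coord_decode:
  assumes "x \<in> kernel_at i" "y \<in> kernel_at i" "a \<in> upto i"
  shows "quot_coord a (lifts b (decode i (code i x))) (lifts c (decode i (code i y))) = co a (quot x y)"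
proof -
  have "agree (upto i) (quot (retr_at b (decode i (code i x))) (retr_at c (decode i (code i y)))) (quot x y)"
    using assms by (intro agree_quot autonomous_upto agree_retr_decode) (auto intro: kernel_at_closed)
  then show ?thesis using assms(3) by (simp add: agree_def quot_coord_def)
qed

text \<open>Retract the points \<open>decode i k\<close> along a section that is continuous at the limit point \<open>k0\<close>. For \<open>k\<close>
  in the factor the result has code \<open>k\<close> and lies in the kernel; by continuity, so does the result
  for \<open>k0\<close>.\<close>

lemma closed_factor: "closed (factor i)"
  unfolding closed_limpt
proof (intro allI impI)
  fix k0 assume "k0 islimpt factor i"
  then have nontriv: "at k0 within factor i \<noteq> bot" by (simp add: trivial_limit_within)
  define y where "y = retr_at (decode i k0) (decode i k0)"
  have y: "y \<in> carrier G" by (simp add: y_def)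
  have lim: "((\<lambda>k. quot_coord a (lifts (decode i k0) (decode i k)) (lifts (coords \<one>) (coords \<one>)))
      \<longlongrightarrow> co a y) (at k0 within factor i)" for a
  proof -
    have "co a y = quot_coord a (lifts (decode i k0) (decode i k0)) (lifts (coords \<one>) (coords \<one>))"
      by (simp add: quot_coord_def y_def)
    then show ?thesis
      using tendsto_quot_coord[where t = "\<lambda>k. decode i k" and ?t0.0 = "decode i k0"
          and s = "\<lambda>_. coords \<one>" and ?s0.0 = "coords \<one>" and F = "at k0 within factor i" and a = a]
      by (simp add: tendsto_decode[OF tendsto_ident_at])
  qed
  have val: "quot_coord a (lifts (decode i k0) (decode i (code i x))) (lifts (coords \<one>) (coords \<one>)) = co a x"
    if x: "x \<in> kernel_at i" and a: "a \<in> upto i" for a x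
    using agree_retr_decode[OF x, of "decode i k0"] x a by (simp add: quot_coord_def agree_def)
  have "agree (before i) y \<one>"
    unfolding agree_def
  proof
    fix a assume a: "a \<in> before i"
    have "\<forall>\<^sub>F k in at k0 within factor i.
        quot_coord a (lifts (decode i k0) (decode i k)) (lifts (coords \<one>) (coords \<one>)) = co a \<one>"
      unfolding eventually_at_filter
    proof (intro always_eventually allI impI)
      fix k assume "k \<in> factor i"
      then obtain x where x: "x \<in> kernel_at i" "k = code i x" by (auto simp: factor_def)
      then have "co a x = co a \<one>" using a by (simp add: kernel_at_def agree_def)
      then show "quot_coord a (lifts (decode i k0) (decode i k)) (lifts (coords \<one>) (coords \<one>)) = co a \<one>"
        using val[OF x(1), of a] a x(2) by (simp add: upto_def)
    qed
    then have "((\<lambda>k. quot_coord a (lifts (decode i k0) (decode i k)) (lifts (coords \<one>) (coords \<one>)))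
      \<longlongrightarrow> co a \<one>) (at k0 within factor i)" by (rule tendsto_eventually)
    then show "co a y = co a \<one>" using tendsto_unique[OF nontriv lim] by simp
  qed
  then have "y \<in> kernel_at i" using y by (simp add: kernel_at_def)
  moreover have "code i y = k0"
  proof
    fix n
    let ?a = "from_nat_into (cl i) n"
    have a: "?a \<in> upto i" using from_nat_into_cl by (simp add: upto_def)
    have ev: "\<forall>\<^sub>F k in at k0 within factor i. k n =
        quot_coord ?a (lifts (decode i k0) (decode i k)) (lifts (coords \<one>) (coords \<one>))"
      unfolding eventually_at_filter
    proof (intro always_eventually allI impI)
      fix k assume "k \<in> factor i"
      then obtain x where x: "x \<in> kernel_at i" "k = code i x" by (auto simp: factor_def)
      show "k n = quot_coord ?a (lifts (decode i k0) (decode i k)) (lifts (coords \<one>) (coords \<one>))"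
        using val[OF x(1) a] x(2) by (simp add: code_def)
    qed
    have "((\<lambda>k. k n) \<longlongrightarrow> k0 n) (at k0 within factor i)"
      using continuous_on_tendsto_compose[OF continuous_on_product_coordinates[of n] tendsto_ident_at] by simp
    then have "((\<lambda>k. quot_coord ?a (lifts (decode i k0) (decode i k)) (lifts (coords \<one>) (coords \<one>)))
      \<longlongrightarrow> k0 n) (at k0 within factor i)"
      using ev by (rule Lim_transform_eventually)
    then show "code i y n = k0 n" using tendsto_unique[OF nontriv lim] by (simp add: code_def)
  qed
  ultimately show "k0 \<in> factor i" by (auto simp: factor_def)
qed

text \<open>At each pair of points, division agrees with its lift along sections that are continuous at these
  two points.\<close>

lemma topological_group_factor: "topological_group (factor_group i) (factor_topology i)"
proof (rule topological_groupI_quotient)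
  show "group (factor_group i)" using group_hom_code[of i] by (simp add: group_hom_def)
  show "topspace (factor_topology i) = carrier (factor_group i)" by (simp add: factor_group_def)
  let ?q = "\<lambda>(k, l). k \<otimes>\<^bsub>factor_group i\<^esub> inv\<^bsub>factor_group i\<^esub> l"
  have q: "?q (code i x, code i y) = code i (quot x y)" if "x \<in> kernel_at i" "y \<in> kernel_at i" for x y
    using quot_factor_group[OF that] by simp
  have "continuous_on (factor i \<times> factor i) (\<lambda>p. ?q p n)" for n
    unfolding continuous_on_def
  proof
    fix p0 assume p0: "p0 \<in> factor i \<times> factor i"
    let ?a = "from_nat_into (cl i) n" and ?F = "at p0 within factor i \<times> factor i"
    let ?b = "decode i (fst p0)" and ?c = "decode i (snd p0)"
    let ?\<gamma> = "\<lambda>p. quot_coord ?a (lifts ?b (decode i (fst p))) (lifts ?c (decode i (snd p)))"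
    have eq: "?q p n = ?\<gamma> p" if "p \<in> factor i \<times> factor i" for p
    proof -
      have "fst p \<in> factor i" "snd p \<in> factor i" using that by auto
      then obtain x y where "fst p = code i x" "x \<in> kernel_at i" "snd p = code i y" "y \<in> kernel_at i"
        unfolding factor_def by (elim imageE)
      then have xy: "x \<in> kernel_at i" "y \<in> kernel_at i" "p = (code i x, code i y)"
        by (simp_all add: prod_eq_iff)
      have "?a \<in> upto i" using from_nat_into_cl by (simp add: upto_def)
      then show ?thesis
        using quot_coord_decode[OF xy(1,2), of ?a ?b ?c] q[OF xy(1,2)] xy(3) by (simp add: code_def)
    qed
    have "(?\<gamma> \<longlongrightarrow> ?\<gamma> p0) ?F"
      by (rule tendsto_quot_coord) (intro tendsto_decode tendsto_fst tendsto_snd tendsto_ident_at)+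
    moreover have "\<forall>\<^sub>F p in ?F. ?\<gamma> p = ?q p n"
      unfolding eventually_at_filter using eq by (intro always_eventually) simp
    ultimately show "((\<lambda>p. ?q p n) \<longlongrightarrow> ?q p0 n) ?F"
      unfolding eq[OF p0] by (rule Lim_transform_eventually)
  qed
  then have "continuous_on (factor i \<times> factor i) ?q"
    by (rule continuous_on_coordinatewise_then_product)
  moreover have "?q ` (factor i \<times> factor i) \<subseteq> factor i"
  proof -
    have "quot x y \<in> kernel_at i" if "x \<in> kernel_at i" "y \<in> kernel_at i" for x y
      using that subgroup.m_closed[OF subgroup_kernel_at] subgroup.m_inv_closed[OF subgroup_kernel_at] by blast
    then show ?thesis using q by (auto simp: factor_def)
  qed
  ultimately show "continuous_map (prod_topology (factor_topology i) (factor_topology i)) (factor_topology i) ?q"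
    unfolding factor_topology_def prod_topology_subtopology_eu
    by (intro continuous_map_into_subtopology) (auto simp: continuous_map_iff_continuous)
qed

theorem Polish_group_factor: "Polish_group (factor_group i) (factor_topology i)"
  unfolding Polish_group_def
proof (intro conjI topological_group_factor)
  have "second_countable (factor_topology i)"
    unfolding factor_topology_def by (intro second_countable_subtopology second_countable_euclidean)
  then show "separable_space (factor_topology i)" by (rule second_countable_imp_separable_space)
  have "completely_metrizable_space (product_topology (\<lambda>_::nat. euclideanreal) UNIV)"
    by (simp add: completely_metrizable_space_product_topology completely_metrizable_space_euclidean)
  then have "completely_metrizable_space (euclidean :: (nat \<Rightarrow> real) topology)"
    by (simp add: euclidean_product_topology)
  then show "completely_metrizable_space (factor_topology i)"
    unfolding factor_topology_def
    using closed_factor by (intro completely_metrizable_space_closedin) auto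
qed

subsection \<open>The Baire isomorphism\<close>

text \<open>Dividing \<open>x\<close> by the section of its projection to \<open>before i\<close> leaves an element of the kernel.\<close>

definition component :: "'a \<Rightarrow> ('a \<Rightarrow> real) \<Rightarrow> nat \<Rightarrow> real" where
  "component x i = code i (quot x (section_at i (coords x)))"

abbreviation factors :: "(('a \<Rightarrow> real) \<Rightarrow> nat \<Rightarrow> real) topology" where
  "factors \<equiv> product_topology factor_topology UNIV"

lemma quot_section_kernel:
  assumes x: "x \<in> carrier G" shows "quot x (section_at i (coords x)) \<in> kernel_at i"
proof -
  have "agree (before i) (quot x (section_at i (coords x))) (quot x x)"
    using x by (intro agree_quot autonomous_before agree_section_at) auto
  then show ?thesis using x by (simp add: kernel_at_def)
qed

lemma component_in: assumes "x \<in> carrier G" shows "component x \<in> topspace factors"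
  using quot_section_kernel[OF assms] by (auto simp: component_def factor_def)

text \<open>The \<open>i\<close>-th component recovers the coordinates in \<open>upto i\<close> from those in \<open>before i\<close>. Injectivity of
  \<open>component\<close> and measurability of its inverse follow by induction along \<open>R\<close>.\<close>

lemma agree_upto_reconstruct:
  assumes x: "x \<in> carrier G"
  shows "agree (upto i) x (retr (decode i (component x i)) \<otimes> section_at i (coords x))"
proof -
  have "agree (upto i) (retr (decode i (component x i))) (quot x (section_at i (coords x)))"
    unfolding component_def by (intro agree_retr_decode quot_section_kernel x)
  then have "agree (upto i) (retr (decode i (component x i)) \<otimes> section_at i (coords x))
      (quot x (section_at i (coords x)) \<otimes> section_at i (coords x))"
    using x by (intro agree_mult autonomous_upto) auto
  then show ?thesis using x by (simp add: m_assoc agree_sym)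
qed

lemma inj_component: "inj_on component (carrier G)"
proof (rule inj_onI)
  fix x y assume xy: "x \<in> carrier G" "y \<in> carrier G" and eq: "component x = component y"
  have "agree (upto i) x y" for i
  proof (induction i rule: wf_induct_rule[OF wf_R])
    case (1 i)
    have "co a x = co a y" if "a \<in> before i" for a
      using before_subset_Un_upto[OF that] 1 by (auto simp: agree_def)
    then have "section_at i (coords x) = section_at i (coords y)" by (rule section_at_cong)
    then show ?case
      using agree_upto_reconstruct[OF xy(1), of i] agree_upto_reconstruct[OF xy(2), of i] eq
      by (metis agree_sym agree_trans)
  qed
  then have "co a x = co a y" for a using mem_cl[of a] by (auto simp: agree_def upto_def)
  with xy show "x = y" by (rule eqI_coordinates)
qed

text \<open>Given elements \<open>y i\<close> of the kernels, define the coordinates \<open>t\<close> of the required point by recursion: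
  coordinates of rank \<open>i\<close> are those of \<open>y i\<close> times the section of what has been constructed before.
  Retracting partial coordinate vectors replaces passage to the inverse limit.\<close>

lemma component_surj:
  assumes k: "k \<in> topspace factors" shows "\<exists>x\<in>carrier G. component x = k"
proof -
  have "\<forall>i. \<exists>y. y \<in> kernel_at i \<and> code i y = k i"
  proof
    fix i
    have "k i \<in> factor i" using k by (simp add: PiE_iff)
    then obtain y where "k i = code i y" "y \<in> kernel_at i" unfolding factor_def by (rule imageE)
    then show "\<exists>y. y \<in> kernel_at i \<and> code i y = k i" by (intro exI[of _ y]) simp
  qed
  from choice[OF this] obtain y where "\<forall>i. y i \<in> kernel_at i \<and> code i (y i) = k i" ..
  then have y: "\<And>i. y i \<in> kernel_at i" "\<And>i. code i (y i) = k i" by blast+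
  have "\<exists>j. a \<in> cl j \<and> (\<forall>l. (l, j) \<in> R \<longrightarrow> a \<notin> cl l)" for a
  proof -
    have "a \<in> {j. a \<in> cl j}" using mem_cl by simp
    with wf_R obtain j where "j \<in> {j. a \<in> cl j}" "\<forall>l. (l, j) \<in> R \<longrightarrow> l \<notin> {j. a \<in> cl j}"
      unfolding wf_eq_minimal by meson
    then show ?thesis by (intro exI[of _ j]) simp
  qed
  then have "\<forall>a. \<exists>j. a \<in> cl j \<and> (\<forall>l. (l, j) \<in> R \<longrightarrow> a \<notin> cl l)" ..
  from choice[OF this] obtain rank where "\<forall>a. a \<in> cl (rank a) \<and> (\<forall>l. (l, rank a) \<in> R \<longrightarrow> a \<notin> cl l)" ..
  then have rank: "\<And>a. a \<in> cl (rank a)" "\<And>a l. (l, rank a) \<in> R \<Longrightarrow> a \<notin> cl l" by blast+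
  have rank_less: "(rank b, rank a) \<in> R" if "b \<in> before (rank a)" for a b
  proof -
    obtain l where l: "(l, rank a) \<in> R" "b \<in> cl l" using \<open>b \<in> before (rank a)\<close> by (auto simp: before_def)
    then have "rank b = l \<or> (rank b, l) \<in> R" using total_R[of "rank b" l] rank(2) by blast
    then show ?thesis using l(1) trans_R by (auto dest: transD)
  qed
  \<comment> \<open>The section at \<open>rank a\<close> reads only coordinates of smaller rank, so the recursion is well founded.\<close>
  define \<Phi> where "\<Phi> f a = co a (y (rank a) \<otimes> section_at (rank a) f)" for f a
  define t where "t = wfrec (inv_image R rank) \<Phi>"
  have t: "t a = co a (y (rank a) \<otimes> section_at (rank a) t)" for a
  proof -
    have "t a = \<Phi> (cut t (inv_image R rank) a) a"
      unfolding t_def by (rule wfrec[OF wf_inv_image[OF wf_R]])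
    also have "section_at (rank a) (cut t (inv_image R rank) a) = section_at (rank a) t"
      by (rule section_at_cong) (simp add: cut_apply rank_less)
    then have "\<Phi> (cut t (inv_image R rank) a) a = co a (y (rank a) \<otimes> section_at (rank a) t)"
      by (simp add: \<Phi>_def)
    finally show ?thesis .
  qed
  define x where "x i = y i \<otimes> section_at i t" for i
  have x_in: "x i \<in> carrier G" for i using kernel_at_closed[OF y(1)] by (simp add: x_def)
  \<comment> \<open>Each coordinate of a retracted point is computed inside some \<open>upto j\<close>, where \<open>t\<close> is realised by \<open>x j\<close>.\<close>
  have glue: "co a (retr s) = t a"
    if IH: "\<And>j a. (j, i) \<in> R \<Longrightarrow> a \<in> upto j \<Longrightarrow> co a (x j) = t a"
      and s: "\<And>a. a \<in> before i \<Longrightarrow> s a = t a" and a: "a \<in> before i" for i s a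
  proof -
    obtain j where j: "(j, i) \<in> R" "a \<in> upto j" using before_subset_Un_upto[OF a] by blast
    have "agree (upto j) (retr s) (x j)"
      using upto_subset_before[OF j(1)] s IH[OF j(1)] x_in
      by (intro agree_retr_at autonomous_upto) auto
    then show ?thesis using j IH by (simp add: agree_def)
  qed
  have x_t: "\<forall>a\<in>upto i. co a (x i) = t a" for i
  proof (induction i rule: wf_induct_rule[OF wf_R])
    case (1 i)
    have sec: "co a (section_at i t) = t a" if "a \<in> before i" for a
      unfolding section_at_def using 1 that by (intro glue[of i]) auto
    have "agree (before i) (x i) (\<one> \<otimes> section_at i t)"
      unfolding x_def using y(1)[of i] by (intro agree_mult autonomous_before) (auto simp: kernel_at_def)
    then have before: "co a (x i) = t a" if "a \<in> before i" for a
      using sec that by (simp add: agree_def)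
    show ?case
    proof
      fix a assume a: "a \<in> upto i"
      show "co a (x i) = t a"
      proof (cases "a \<in> before i")
        case True then show ?thesis by (rule before)
      next
        case False
        then have "a \<in> cl i" using a by (simp add: upto_def)
        have "\<not> (rank a, i) \<in> R" using False rank(1)[of a] by (auto simp: before_def)
        moreover have "\<not> (i, rank a) \<in> R" using rank(2) \<open>a \<in> cl i\<close> by blast
        ultimately have "rank a = i" using total_R by blast
        then show ?thesis using t[of a] by (simp add: x_def)
      qed
    qed
  qed
  define z where "z = retr t"
  have z: "z \<in> carrier G" by (simp add: z_def)
  have z_t: "co a z = t a" for a
  proof -
    have "agree (upto a) (retr t) (x a)"
      using x_t x_in by (intro agree_retr_at autonomous_upto) auto
    moreover have "a \<in> upto a" using mem_cl by (simp add: upto_def)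
    ultimately show ?thesis using x_t by (simp add: agree_def z_def)
  qed
  have "component z i = k i" for i
  proof -
    have sec: "section_at i (coords z) = section_at i t" by (rule section_at_cong) (rule z_t)
    have "agree (cl i) z (x i)" using x_t z_t by (auto simp: agree_def upto_def)
    then have "agree (cl i) (quot z (section_at i t)) (quot (x i) (section_at i t))"
      using z x_in by (intro agree_quot autonomous_cl) auto
    moreover have "quot (x i) (section_at i t) = y i"
      using kernel_at_closed[OF y(1)[of i]] by (simp add: x_def m_assoc)
    ultimately have "code i (quot z (section_at i t)) = code i (y i)" by (simp add: code_eq_iff)
    then show ?thesis by (simp add: component_def sec y)
  qed
  with z show ?thesis by blast
qed

lemma bij_component: "bij_betw component (carrier G) (topspace factors)"
  unfolding bij_betw_def using inj_component component_in component_surj by blast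

lemma measurable_section_at:
  assumes "\<And>a. a \<in> before i \<Longrightarrow> (\<lambda>x. t x a) \<in> borel_measurable M"
  shows "(\<lambda>x. section_at i (t x)) \<in> M \<rightarrow>\<^sub>M Baire_algebra T"
  unfolding section_at_def
proof (rule measurable_retr)
  show "(\<lambda>x. if a \<in> before i then t x a else 0) \<in> borel_measurable M" for a
    using assms[of a] by (cases "a \<in> before i") simp_all
qed

lemma Baire_map_component: "Baire_map T factors component"
proof -
  have "\<exists>\<B>. countable_base_product factor_topology UNIV \<B>"
    unfolding factor_topology_def
    by (intro countable_base_product_second_countable second_countable_subtopology second_countable_euclidean)
  then obtain \<B> where "countable_base_product factor_topology UNIV \<B>" by blast
  then interpret P: countable_base_product factor_topology UNIV \<B> .
  have id: "(\<lambda>x. x) \<in> Baire_algebra T \<rightarrow>\<^sub>M Baire_algebra T" by simp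
  have co: "co a \<in> borel_measurable (Baire_algebra T)" for a
    by (intro borel_measurable_Baire_algebra continuous_map_coordinate)
  show ?thesis
    unfolding Baire_map_def
  proof (rule P.measurable_product_Baire_algebraI)
    show "component \<in> space (Baire_algebra T) \<rightarrow> topspace factors" using component_in by auto
    fix i B assume "B \<in> \<B> i"
    then have "openin (factor_topology i) B" by (simp add: P.base_open)
    then obtain O' where O': "open O'" "B = O' \<inter> factor i"
      by (auto simp: factor_topology_def openin_subtopology)
    have "(\<lambda>x. quot x (section_at i (coords x))) \<in> Baire_algebra T \<rightarrow>\<^sub>M Baire_algebra T"
      by (intro measurable_quot id measurable_section_at co)
    then have "(\<lambda>x. component x i n) \<in> borel_measurable (Baire_algebra T)" for n
      unfolding measurable_Baire_coordinates_iff by (simp add: component_def code_def)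
    then have "(\<lambda>x. component x i) \<in> borel_measurable (Baire_algebra T)"
      by (rule measurable_coordinatewise_then_product)
    then have "(\<lambda>x. component x i) -` O' \<inter> space (Baire_algebra T) \<in> sets (Baire_algebra T)"
      by (rule measurable_sets) (simp add: O' borel_open)
    moreover have "{x \<in> space (Baire_algebra T). component x i \<in> B} = (\<lambda>x. component x i) -` O' \<inter> space (Baire_algebra T)"
      using component_in O' by (auto simp: PiE_iff)
    ultimately show "{x \<in> space (Baire_algebra T). component x i \<in> B} \<in> sets (Baire_algebra T)" by simp
  qed
qed

text \<open>The recursion that inverts \<open>component\<close> expresses each coordinate of the result by
  measurable operations from the given components and from coordinates before it.\<close>

lemma Baire_map_inverse_component: "Baire_map factors T (inv_into (carrier G) component)"
proof -
  define \<Psi> where "\<Psi> = inv_into (carrier G) component"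
  have \<Psi>: "\<Psi> k \<in> carrier G" "component (\<Psi> k) = k" if "k \<in> topspace factors" for k
    using bij_component that unfolding \<Psi>_def bij_betw_def by (auto intro: inv_into_into f_inv_into_f)
  have coordinate: "(\<lambda>k. k i n) \<in> borel_measurable (Baire_algebra factors)" for i n
  proof (rule borel_measurable_Baire_algebra)
    have "continuous_map factors (factor_topology i) (\<lambda>k. k i)"
      by (rule continuous_map_product_projection) simp
    then have "continuous_map factors euclidean (\<lambda>k. k i)"
      unfolding factor_topology_def by (rule continuous_map_into_fulltopology)
    moreover have "continuous_map euclidean euclideanreal (\<lambda>f::nat \<Rightarrow> real. f n)" by simp
    ultimately have "continuous_map factors euclideanreal ((\<lambda>f. f n) \<circ> (\<lambda>k. k i))"
      by (rule continuous_map_compose)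
    then show "continuous_map factors euclideanreal (\<lambda>k. k i n)" by (simp add: o_def)
  qed
  have "\<forall>a\<in>upto i. (\<lambda>k. co a (\<Psi> k)) \<in> borel_measurable (Baire_algebra factors)" for i
  proof (induction i rule: wf_induct_rule[OF wf_R])
    case (1 i)
    have "(\<lambda>k. co a (\<Psi> k)) \<in> borel_measurable (Baire_algebra factors)" if "a \<in> before i" for a
      using before_subset_Un_upto[OF that] 1 by blast
    then have "(\<lambda>k. section_at i (coords (\<Psi> k))) \<in> Baire_algebra factors \<rightarrow>\<^sub>M Baire_algebra T"
      by (rule measurable_section_at)
    moreover have "(\<lambda>k. retr (decode i (k i))) \<in> Baire_algebra factors \<rightarrow>\<^sub>M Baire_algebra T"
    proof (rule measurable_retr)
      show "(\<lambda>k. decode i (k i) a) \<in> borel_measurable (Baire_algebra factors)" for a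
        using coordinate[of i "to_nat_on (cl i) a"]
        by (cases "a \<in> before i"; cases "a \<in> cl i") (simp_all add: decode_def)
    qed
    ultimately have m: "(\<lambda>k. retr (decode i (k i)) \<otimes> section_at i (coords (\<Psi> k)))
        \<in> Baire_algebra factors \<rightarrow>\<^sub>M Baire_algebra T"
      by (rule measurable_mult[rotated])
    show ?case
    proof
      fix a assume a: "a \<in> upto i"
      have "(\<lambda>k. co a (retr (decode i (k i)) \<otimes> section_at i (coords (\<Psi> k)))) \<in> borel_measurable (Baire_algebra factors)"
        using m unfolding measurable_Baire_coordinates_iff by blast
      then show "(\<lambda>k. co a (\<Psi> k)) \<in> borel_measurable (Baire_algebra factors)"
      proof (rule measurable_cong[THEN iffD1, rotated])
        fix k assume "k \<in> space (Baire_algebra factors)"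
        then have k: "k \<in> topspace factors" by simp
        show "co a (retr (decode i (k i)) \<otimes> section_at i (coords (\<Psi> k))) = co a (\<Psi> k)"
          using agree_upto_reconstruct[OF \<Psi>(1)[OF k], of i] a \<Psi>(2)[OF k] by (simp add: agree_def)
      qed
    qed
  qed
  then have "(\<lambda>k. co a (\<Psi> k)) \<in> borel_measurable (Baire_algebra factors)" for a
    using mem_cl[of a] by (auto simp: upto_def)
  then show ?thesis
    unfolding Baire_map_def \<Psi>_def[symmetric] measurable_Baire_coordinates_iff using \<Psi>(1) by auto
qed

theorem Baire_isomorphism_component: "Baire_isomorphism T factors component"
  unfolding Baire_isomorphism_def
  using bij_component Baire_map_component Baire_map_inverse_component by simp

end

theorem theorem4p8:
  fixes G :: "('a, 'm) monoid_scheme" and T :: "'a topology"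
  assumes "AE0_group G T"
  shows "\<exists>(I :: ('a \<Rightarrow> real) set) (H :: ('a \<Rightarrow> real) \<Rightarrow> (nat \<Rightarrow> real) monoid)
            (S :: ('a \<Rightarrow> real) \<Rightarrow> (nat \<Rightarrow> real) topology).
           (\<forall>i\<in>I. Polish_group (H i) (S i)) \<and> Baire_isomorphic T (product_topology S I)"
proof -
  have tg: "topological_group G T" and ae: "AE0_space T"
    using assms by (auto simp: AE0_group_def)
  have top: "topspace T = carrier G" and "group G"
    using tg by (auto simp: topological_group_def)
  obtain g where g: "continuous_map euclidean T g"
    "\<forall>x\<in>topspace T. \<forall>z. limits z = (\<lambda>i. coordinate T i x) \<longrightarrow> g z = x"
    using AE0_space_retraction[OF ae] by blast
  interpret group G by fact
  interpret retracted_group G T g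
    by unfold_locales (use tg g top in auto)
  have "\<forall>i. \<exists>A. countable A \<and> i \<in> A \<and> autonomous A"
    by (intro allI countable_autonomous_set)
  from choice[OF this] obtain cl where cl: "\<forall>i. countable (cl i) \<and> i \<in> cl i \<and> autonomous (cl i)" ..
  obtain r :: "(('a \<Rightarrow> real) \<times> ('a \<Rightarrow> real)) set" where r: "Well_order r \<and> Field r = UNIV"
    using well_ordering ..
  have "well_order_on UNIV r"
    using r[THEN conjunct1] unfolding r[THEN conjunct2] .
  then have lin: "linear_order_on UNIV r" and wf: "wf (r - Id)"
    unfolding well_order_on_def by simp_all
  interpret autonomous_filtration G T g cl "r - Id"
  proof
    show "trans (r - Id)"
      using lin unfolding linear_order_on_def partial_order_on_def preorder_on_def
      by (auto intro: trans_diff_Id)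
    show "(i, j) \<in> r - Id \<or> (j, i) \<in> r - Id" if "i \<noteq> j" for i j
      using lin that unfolding linear_order_on_def total_on_def by auto
  qed (use cl wf in auto)
  show ?thesis
    unfolding Baire_isomorphic_def
    by (intro exI[of _ UNIV] exI[of _ factor_group] exI[of _ factor_topology] conjI ballI
        exI[of _ component] Polish_group_factor Baire_isomorphism_component)
qed

end
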